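(* Let $q,d\ge 3$ be integers. As $\ell\to\infty$, $$\int_{0}^{\frac{\pi}{2}}G_{\ell;d}(\cos\vartheta)^{q}(\sin\vartheta)^{d-1}\,d\vartheta=\frac{c_{q;d}}{\ell^{d}}\,(1+o_{q;d}(1)),$$ where the constants $c_{q;d}$ are given by $$c_{q;d}=\left(2^{\frac d2-1}\left(\tfrac d2-1\right)!\right)^{q}\int_{0}^{+\infty}J_{\frac d2-1}(\psi)^{q}\,\psi^{-q\left(\frac d2-1\right)+d-1}\,d\psi .$$ The integral on the right-hand side of this formula is absolutely convergent for every pair $(d,q)\ne(3,3)$ (with $q,d\geq 3$) and conditionally convergent for $d=q=3$.
   Context: $G_{\ell;d}:[-1,1]\to\mathbb{R}$ denotes the $\ell$-th Gegenbauer polynomial, i.e. the Jacobi polynomial $P_\ell^{(\frac d2-1,\frac d2-1)}$ (orthogonal on $[-1,1]$ with respect to the weight $(1-t^2)^{\frac d2-1}$, of degree $\ell$), normalized so that $G_{\ell;d}(1)=1$. $J_{\nu}$ is the Bessel function of the first kind of order $\nu$. For odd $d$, $(\frac d2-1)!$ means $\Gamma(\frac d2)$. The symbol $o_{q;d}(1)$ denotes a quantity tending to $0$ as $\ell\to\infty$ for fixed $q,d$. Conditionally convergent means that the improper integral $\lim_{R\to\infty}\int_0^R$ exists but the integral is not absolutely convergent. *)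

theory Defs
  imports "HOL-Analysis.Analysis" "HOL-Library.Landau_Symbols"
    "HOL-Computational_Algebra.Polynomial"
begin

section \<open>Jacobi and Gegenbauer polynomials\<close>

text \<open>
  Classical explicit formula (equivalent to Rodrigues' formula):
  P_n(x) = \<Sum>s. C(n + \<alpha>, n - s) C(n + \<beta>, s) ((x - 1)/2)^s ((x + 1)/2)^(n - s).
  That this is the orthogonal polynomial of degree n for the weight
  (1 - x)^\<alpha> (1 + x)^\<beta> is \<open>degree_jacobi_poly\<close> and, for \<alpha>, \<beta> > 0,
  \<open>jacobi_poly_orthogonal\<close> below.
\<close>

definition jacobi_poly :: "real \<Rightarrow> real \<Rightarrow> nat \<Rightarrow> real poly" where
  "jacobi_poly \<alpha> \<beta> n =
     (\<Sum>s\<le>n. smult (((real n + \<alpha>) gchoose (n - s)) * ((real n + \<beta>) gchoose s))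
        ([:- 1 / 2, 1 / 2:] ^ s * [:1 / 2, 1 / 2:] ^ (n - s)))"

definition gegenbauer_poly :: "nat \<Rightarrow> nat \<Rightarrow> real poly" where
  "gegenbauer_poly d l =
     (let P = jacobi_poly (real d / 2 - 1) (real d / 2 - 1) l in smult (1 / poly P 1) P)"

lemma poly_jacobi_poly:
  "poly (jacobi_poly \<alpha> \<beta> n) x =
     (\<Sum>s\<le>n. ((real n + \<alpha>) gchoose (n - s)) * ((real n + \<beta>) gchoose s) *
        (((x - 1) / 2) ^ s * ((x + 1) / 2) ^ (n - s)))"
proof -
  have "poly [:- 1 / 2, 1 / 2:] x = (x - 1) / 2" "poly [:1 / 2, 1 / 2:] x = (x + 1) / 2"
    by (simp_all add: field_simps)
  thus ?thesis
    unfolding jacobi_poly_def poly_sum poly_smult poly_mult poly_power by (simp only:)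
qed

lemma poly_jacobi_poly_1: "poly (jacobi_poly \<alpha> \<beta> n) 1 = (real n + \<alpha>) gchoose n"
proof -
  have "poly (jacobi_poly \<alpha> \<beta> n) 1 =
      (\<Sum>s\<le>n. if s = 0 then (real n + \<alpha>) gchoose n else 0)"
    unfolding poly_jacobi_poly by (rule sum.cong) (auto simp: power_0_left)
  thus ?thesis by simp
qed

lemma gbinomial_pos:
  fixes a :: real
  assumes "a > real k - 1"
  shows "a gchoose k > 0"
  unfolding gbinomial_prod_rev using assms by (intro divide_pos_pos prod_pos) auto

lemma poly_gegenbauer_poly_1:
  assumes "d \<ge> 1"
  shows "poly (gegenbauer_poly d l) 1 = 1"
proof -
  have "(real l + (real d / 2 - 1)) gchoose l > 0"
    using assms by (intro gbinomial_pos) auto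
  thus ?thesis by (simp add: gegenbauer_poly_def Let_def poly_jacobi_poly_1)
qed

lemma coeff_mult_top:
  fixes p r :: "real poly"
  assumes "degree p \<le> m" "degree r \<le> n"
  shows "coeff (p * r) (m + n) = coeff p m * coeff r n"
proof (cases "degree p = m \<and> degree r = n")
  case True
  thus ?thesis using coeff_mult_degree_sum[of p r] by auto
next
  case False
  hence *: "degree p < m \<or> degree r < n" using assms by auto
  hence "degree (p * r) < m + n" using assms degree_mult_le[of p r] by linarith
  with * show ?thesis by (auto simp: coeff_eq_0)
qed

lemma coeff_linear_power_top:
  fixes a b :: real
  shows "degree ([:a, b:] ^ n) \<le> n \<and> coeff ([:a, b:] ^ n) n = b ^ n"
proof (induction n)
  case (Suc n)
  have d: "degree [:a, b:] \<le> 1" by simp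
  have "coeff ([:a, b:] * [:a, b:] ^ n) (1 + n) = coeff [:a, b:] 1 * coeff ([:a, b:] ^ n) n"
    using Suc d by (intro coeff_mult_top) auto
  moreover have "degree ([:a, b:] * [:a, b:] ^ n) \<le> 1 + n"
    using Suc d by (intro order.trans[OF degree_mult_le] add_mono) auto
  ultimately show ?case using Suc by simp
qed simp

lemma degree_jacobi_poly:
  assumes "\<alpha> > -1" "\<beta> > -1"
  shows "degree (jacobi_poly \<alpha> \<beta> n) = n"
proof (cases "n = 0")
  case False
  let ?X = "\<lambda>s. [:- 1 / 2, 1 / 2:] ^ s * [:1 / 2, 1 / 2:] ^ (n - s) :: real poly"
  have X: "degree (?X s) \<le> n \<and> coeff (?X s) n = (1 / 2) ^ n" if "s \<le> n" for s
  proof -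
    note A = coeff_linear_power_top[of "-1/2" "1/2" s]
    note B = coeff_linear_power_top[of "1/2" "1/2" "n - s"]
    have "degree (?X s) \<le> s + (n - s)"
      using A B by (intro order.trans[OF degree_mult_le] add_mono) auto
    moreover have "coeff (?X s) (s + (n - s)) = (1 / 2) ^ s * (1 / 2) ^ (n - s)"
      using A B by (subst coeff_mult_top) auto
    ultimately show ?thesis using that by (simp flip: power_add)
  qed
  have "coeff (jacobi_poly \<alpha> \<beta> n) n =
      (\<Sum>s\<le>n. ((real n + \<beta>) gchoose s) * ((real n + \<alpha>) gchoose (n - s))) * (1 / 2) ^ n"
    unfolding jacobi_poly_def coeff_sum sum_distrib_right
    using X by (intro sum.cong) auto
  also have "\<dots> = ((real n + \<beta> + (real n + \<alpha>)) gchoose n) * (1 / 2) ^ n"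
    using gbinomial_Vandermonde[of "real n + \<beta>" "real n + \<alpha>" n]
    by (simp add: atLeast0AtMost)
  finally have "coeff (jacobi_poly \<alpha> \<beta> n) n > 0"
    using assms False by (auto intro!: mult_pos_pos gbinomial_pos)
  moreover have "degree (jacobi_poly \<alpha> \<beta> n) \<le> n"
    unfolding jacobi_poly_def using X
    by (intro degree_sum_le) (auto intro: order.trans[OF degree_smult_le])
  ultimately show ?thesis
    by (metis le_degree order_antisym less_irrefl)
qed (simp add: jacobi_poly_def)

lemma gbinomial_step:
  fixes a :: real
  shows "(a - real k) * (a gchoose k) = (real k + 1) * (a gchoose Suc k)"
  using gbinomial_mult_1[of a k] by (simp add: algebra_simps)

text \<open>The identity d/dx ((1-x)^(\<alpha>+1) (1+x)^(\<beta>+1) P_n^(\<alpha>+1,\<beta>+1)) =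
  -2(n+1) (1-x)^\<alpha> (1+x)^\<beta> P_{n+1}^(\<alpha>,\<beta>), with the powers divided out:\<close>

lemma jacobi_poly_raise:
  "(1 - x) * (1 + x) * poly (pderiv (jacobi_poly (\<alpha> + 1) (\<beta> + 1) n)) x
     + ((\<beta> + 1) * (1 - x) - (\<alpha> + 1) * (1 + x)) * poly (jacobi_poly (\<alpha> + 1) (\<beta> + 1) n) x
   = - 2 * (real n + 1) * poly (jacobi_poly \<alpha> \<beta> (Suc n)) x"
proof -
  define N M where "N = real n + (\<alpha> + 1)" and "M = real n + (\<beta> + 1)"
  define u v where "u = (x - 1) / 2" and "v = (x + 1) / 2"
  define q where "q s = (N gchoose (n - s)) * (M gchoose s)" for s
  have x: "1 - x = - 2 * u" "1 + x = 2 * v" by (simp_all add: u_def v_def)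
  have tm: "(1 - x) * (1 + x) *
         (real s * u ^ (s - 1) / 2 * v ^ (n - s) + u ^ s * (real (n - s) * v ^ (n - s - 1) / 2))
       + ((\<beta> + 1) * (1 - x) - (\<alpha> + 1) * (1 + x)) * (u ^ s * v ^ (n - s))
     = - 2 * (real s + \<alpha> + 1) * (u ^ s * v ^ (Suc n - s))
       - 2 * (real (n - s) + \<beta> + 1) * (u ^ Suc s * v ^ (n - s))" if "s \<le> n" for s
  proof -
    have a: "u * (real s * u ^ (s - 1)) = real s * u ^ s" by (cases s) auto
    have b: "v * (real (n - s) * v ^ (n - s - 1)) = real (n - s) * v ^ (n - s)"
      by (cases "n - s") auto
    have c: "v ^ (Suc n - s) = v * v ^ (n - s)" using that by (simp add: Suc_diff_le)
    have "(1 - x) * (1 + x) *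
         (real s * u ^ (s - 1) / 2 * v ^ (n - s) + u ^ s * (real (n - s) * v ^ (n - s - 1) / 2))
       = - 2 * ((u * (real s * u ^ (s - 1))) * (v * v ^ (n - s))
           + u * u ^ s * (v * (real (n - s) * v ^ (n - s - 1))))"
      unfolding x by (simp add: algebra_simps)
    thus ?thesis unfolding a b c unfolding x by (simp add: algebra_simps)
  qed
  have P: "poly (jacobi_poly (\<alpha> + 1) (\<beta> + 1) n) x = (\<Sum>s\<le>n. q s * (u ^ s * v ^ (n - s)))"
    by (simp add: poly_jacobi_poly q_def N_def M_def u_def v_def)
  have "((\<lambda>x. \<Sum>s\<le>n. q s * (((x - 1) / 2) ^ s * ((x + 1) / 2) ^ (n - s)))
     has_real_derivative (\<Sum>s\<le>n. q s * (real s * u ^ (s - 1) / 2 * v ^ (n - s)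
        + u ^ s * (real (n - s) * v ^ (n - s - 1) / 2)))) (at x)"
  proof (intro DERIV_sum DERIV_cmult)
    fix s
    have "((\<lambda>x. ((x - 1) / 2) ^ s) has_real_derivative real s * u ^ (s - 1) / 2) (at x)"
      unfolding u_def by (rule derivative_eq_intros refl | simp)+
    moreover have "((\<lambda>x. ((x + 1) / 2) ^ (n - s)) has_real_derivative
        real (n - s) * v ^ (n - s - 1) / 2) (at x)"
      unfolding v_def by (rule derivative_eq_intros refl | simp)+
    ultimately have "((\<lambda>x. ((x - 1) / 2) ^ s * ((x + 1) / 2) ^ (n - s)) has_real_derivative
        real s * u ^ (s - 1) / 2 * ((x + 1) / 2) ^ (n - s)
          + real (n - s) * v ^ (n - s - 1) / 2 * ((x - 1) / 2) ^ s) (at x)"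
      by (rule DERIV_mult)
    thus "((\<lambda>x. ((x - 1) / 2) ^ s * ((x + 1) / 2) ^ (n - s)) has_real_derivative
        real s * u ^ (s - 1) / 2 * v ^ (n - s) + u ^ s * (real (n - s) * v ^ (n - s - 1) / 2)) (at x)"
      unfolding u_def[symmetric] v_def[symmetric] by (simp only: mult.commute)
  qed
  moreover have "(\<lambda>x. \<Sum>s\<le>n. q s * (((x - 1) / 2) ^ s * ((x + 1) / 2) ^ (n - s)))
      = poly (jacobi_poly (\<alpha> + 1) (\<beta> + 1) n)"
    by (simp add: poly_jacobi_poly q_def N_def M_def fun_eq_iff)
  ultimately have "(poly (jacobi_poly (\<alpha> + 1) (\<beta> + 1) n) has_real_derivative
      (\<Sum>s\<le>n. q s * (real s * u ^ (s - 1) / 2 * v ^ (n - s)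
        + u ^ s * (real (n - s) * v ^ (n - s - 1) / 2)))) (at x)"
    by (simp only:)
  hence D: "poly (pderiv (jacobi_poly (\<alpha> + 1) (\<beta> + 1) n)) x =
      (\<Sum>s\<le>n. q s * (real s * u ^ (s - 1) / 2 * v ^ (n - s)
        + u ^ s * (real (n - s) * v ^ (n - s - 1) / 2)))"
    by (rule DERIV_unique[OF poly_DERIV])
  have arith: "A * (B * C) + E * (B * F) = B * (A * C + E * F)" for A B C E F :: real
    by (simp add: distrib_left mult_ac)
  have "(1 - x) * (1 + x) * poly (pderiv (jacobi_poly (\<alpha> + 1) (\<beta> + 1) n)) x
     + ((\<beta> + 1) * (1 - x) - (\<alpha> + 1) * (1 + x)) * poly (jacobi_poly (\<alpha> + 1) (\<beta> + 1) n) x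
    = (\<Sum>s\<le>n. q s * ((1 - x) * (1 + x) *
         (real s * u ^ (s - 1) / 2 * v ^ (n - s) + u ^ s * (real (n - s) * v ^ (n - s - 1) / 2))
       + ((\<beta> + 1) * (1 - x) - (\<alpha> + 1) * (1 + x)) * (u ^ s * v ^ (n - s))))"
    unfolding D P sum_distrib_left sum.distrib[symmetric]
    by (intro sum.cong refl) (rule arith)
  also have "\<dots> = (\<Sum>s\<le>n. q s * (- 2 * (real s + \<alpha> + 1) * (u ^ s * v ^ (Suc n - s))
       - 2 * (real (n - s) + \<beta> + 1) * (u ^ Suc s * v ^ (n - s))))"
    using tm by (intro sum.cong) auto
  also have "\<dots> = - 2 * ((\<Sum>s\<le>n. q s * (real s + \<alpha> + 1) * (u ^ s * v ^ (Suc n - s)))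
       + (\<Sum>s\<le>n. q s * (real (n - s) + \<beta> + 1) * (u ^ Suc s * v ^ (Suc n - Suc s))))"
    unfolding sum.distrib[symmetric] sum_distrib_left
    by (intro sum.cong) (auto simp: algebra_simps)
  also have "(\<Sum>s\<le>n. q s * (real s + \<alpha> + 1) * (u ^ s * v ^ (Suc n - s)))
     = (\<Sum>s\<le>Suc n. real (Suc n - s) * (N gchoose (Suc n - s)) * (M gchoose s) *
          (u ^ s * v ^ (Suc n - s)))"
  proof -
    have "q s * (real s + \<alpha> + 1) = real (Suc n - s) * (N gchoose (Suc n - s)) * (M gchoose s)"
      if "s \<le> n" for s
    proof -
      have "(real s + \<alpha> + 1) * (N gchoose (n - s)) = real (Suc n - s) * (N gchoose (Suc n - s))"
        using gbinomial_step[of N "n - s"] that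
        by (simp add: N_def Suc_diff_le of_nat_diff algebra_simps)
      thus ?thesis by (simp add: q_def mult_ac)
    qed
    thus ?thesis by simp
  qed
  also have "(\<Sum>s\<le>n. q s * (real (n - s) + \<beta> + 1) * (u ^ Suc s * v ^ (Suc n - Suc s)))
     = (\<Sum>s\<le>Suc n. real s * (N gchoose (Suc n - s)) * (M gchoose s) *
          (u ^ s * v ^ (Suc n - s)))"
  proof -
    have "q s * (real (n - s) + \<beta> + 1)
        = real (Suc s) * (N gchoose (Suc n - Suc s)) * (M gchoose Suc s)" if "s \<le> n" for s
    proof -
      have "(real (n - s) + \<beta> + 1) * (M gchoose s) = real (Suc s) * (M gchoose Suc s)"
        using gbinomial_step[of M s] that by (simp add: M_def of_nat_diff algebra_simps)
      thus ?thesis by (simp add: q_def mult_ac)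
    qed
    thus ?thesis by (subst sum.atMost_Suc_shift) simp
  qed
  also have "(\<Sum>s\<le>Suc n. real (Suc n - s) * (N gchoose (Suc n - s)) * (M gchoose s) *
          (u ^ s * v ^ (Suc n - s))) + (\<Sum>s\<le>Suc n. real s * (N gchoose (Suc n - s)) *
          (M gchoose s) * (u ^ s * v ^ (Suc n - s)))
     = (real n + 1) * (\<Sum>s\<le>Suc n. (N gchoose (Suc n - s)) * (M gchoose s) *
          (u ^ s * v ^ (Suc n - s)))"
  proof -
    have *: "real (Suc n - s) = real n + 1 - real s" if "s \<le> Suc n" for s
      using that by (simp add: of_nat_diff)
    show ?thesis unfolding sum.distrib[symmetric] sum_distrib_left
      by (intro sum.cong refl) (simp add: * algebra_simps)
  qed
  also have "(\<Sum>s\<le>Suc n. (N gchoose (Suc n - s)) * (M gchoose s) * (u ^ s * v ^ (Suc n - s)))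
      = poly (jacobi_poly \<alpha> \<beta> (Suc n)) x"
  proof -
    have "N = real (Suc n) + \<alpha>" "M = real (Suc n) + \<beta>" by (simp_all add: N_def M_def)
    thus ?thesis by (simp only: poly_jacobi_poly u_def v_def)
  qed
  finally show ?thesis by (simp only: mult.assoc)
qed

lemma has_integral_0_cancel:
  fixes f :: "real \<Rightarrow> real"
  assumes "((\<lambda>x. c * f x) has_integral 0) S" "c \<noteq> 0"
  shows "(f has_integral 0) S"
  using has_integral_mult_right[OF assms(1), of "1 / c"] assms(2) by simp

lemma jacobi_poly_orthogonal:
  assumes "\<alpha> > 0" "\<beta> > 0" "degree p < n"
  shows "((\<lambda>x. (1 - x) powr \<alpha> * (1 + x) powr \<beta> * poly (jacobi_poly \<alpha> \<beta> n) x * poly p x)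
           has_integral 0) {-1..1}"
  using assms
proof (induction n arbitrary: \<alpha> \<beta> p)
  case 0
  from \<open>degree p < 0\<close> show ?case by (rule less_zeroE)
next
  case (Suc n)
  let ?Q = "jacobi_poly (\<alpha> + 1) (\<beta> + 1) n"
  let ?W = "\<lambda>x. (1 - x) powr (\<alpha> + 1) * (1 + x) powr (\<beta> + 1)"
  let ?w = "\<lambda>x. (1 - x) powr \<alpha> * (1 + x) powr \<beta>"
  let ?f = "\<lambda>x. - 2 * (real n + 1) * (?w x * poly (jacobi_poly \<alpha> \<beta> (Suc n)) x * poly p x)
               + ?W x * poly ?Q x * poly (pderiv p) x"
  have "(?f has_integral (?W 1 * poly ?Q 1 * poly p 1 - ?W (-1) * poly ?Q (-1) * poly p (-1)))
          {-1..1}"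
  proof (rule fundamental_theorem_of_calculus_interior)
    show "continuous_on {-1..1} (\<lambda>x. ?W x * poly ?Q x * poly p x)"
      using Suc.prems by (intro continuous_intros continuous_on_powr') auto
    fix x :: real assume "x \<in> {-1<..<1}"
    hence x: "1 - x > 0" "1 + x > 0" by auto
    have W: "?W x = (1 - x) * (1 + x) * ?w x" using x by (simp add: powr_add)
    have "(?W has_real_derivative
        (1 - x) powr \<alpha> * (1 + x) powr \<beta> * ((\<beta> + 1) * (1 - x) - (\<alpha> + 1) * (1 + x))) (at x)"
    proof -
      have "((\<lambda>x. (1 - x) powr (\<alpha> + 1)) has_real_derivative
          (\<alpha> + 1) * (1 - x) powr (\<alpha> + 1 - of_nat 1) * (- 1)) (at x)"
        using x by (intro DERIV_fun_powr) (auto intro!: derivative_eq_intros)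
      moreover have "((\<lambda>x. (1 + x) powr (\<beta> + 1)) has_real_derivative
          (\<beta> + 1) * (1 + x) powr (\<beta> + 1 - of_nat 1) * 1) (at x)"
        using x by (intro DERIV_fun_powr) (auto intro!: derivative_eq_intros)
      ultimately have "(?W has_real_derivative
          (\<alpha> + 1) * (1 - x) powr (\<alpha> + 1 - of_nat 1) * (- 1) * (1 + x) powr (\<beta> + 1)
          + (\<beta> + 1) * (1 + x) powr (\<beta> + 1 - of_nat 1) * 1 * (1 - x) powr (\<alpha> + 1)) (at x)"
        by (rule DERIV_mult)
      moreover have pw: "(1 - x) powr (\<alpha> + 1) = (1 - x) powr \<alpha> * (1 - x)"
        "(1 + x) powr (\<beta> + 1) = (1 + x) powr \<beta> * (1 + x)" using x by (simp_all add: powr_add)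
      ultimately show ?thesis
        by - (erule DERIV_cong, unfold pw, simp add: algebra_simps)
    qed
    hence "((\<lambda>x. ?W x * poly ?Q x * poly p x) has_real_derivative
        (?w x * ((\<beta> + 1) * (1 - x) - (\<alpha> + 1) * (1 + x)) * poly ?Q x
          + poly (pderiv ?Q) x * ?W x) * poly p x
        + poly (pderiv p) x * (?W x * poly ?Q x)) (at x)"
      by (intro DERIV_mult poly_DERIV)
    moreover have "?w x * ((\<beta> + 1) * (1 - x) - (\<alpha> + 1) * (1 + x)) * poly ?Q x
          + poly (pderiv ?Q) x * ?W x
        = ?w x * (- 2 * (real n + 1) * poly (jacobi_poly \<alpha> \<beta> (Suc n)) x)"
    proof -
      have "A * B * C + D * (E * A) = A * (E * D + B * C)" for A B C D E :: real
        by (simp add: distrib_left mult_ac)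
      thus ?thesis unfolding W jacobi_poly_raise[symmetric] .
    qed
    ultimately show "((\<lambda>x. ?W x * poly ?Q x * poly p x) has_vector_derivative ?f x) (at x)"
      by (simp add: has_real_derivative_iff_has_vector_derivative[symmetric] mult_ac)
  qed simp
  hence A: "(?f has_integral 0) {-1..1}" using Suc.prems by simp
  have B: "((\<lambda>x. ?W x * poly ?Q x * poly (pderiv p) x) has_integral 0) {-1..1}"
  proof (cases "pderiv p = 0")
    case False
    hence "degree p \<noteq> 0" by (simp add: pderiv_eq_0_iff)
    with Suc.prems show ?thesis by (intro Suc.IH) (auto simp: degree_pderiv)
  qed simp
  have "((\<lambda>x. - 2 * (real n + 1) *
      (?w x * poly (jacobi_poly \<alpha> \<beta> (Suc n)) x * poly p x)) has_integral 0) {-1..1}"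
    using has_integral_diff[OF A B] by simp
  moreover have "- 2 * (real n + 1) \<noteq> 0" by simp
  ultimately show ?case by (rule has_integral_0_cancel)
qed

lemma degree_gegenbauer_poly:
  assumes "d \<ge> 1"
  shows "degree (gegenbauer_poly d l) = l"
proof -
  have "(real l + (real d / 2 - 1)) gchoose l > 0"
    using assms by (intro gbinomial_pos) auto
  moreover have "degree (jacobi_poly (real d / 2 - 1) (real d / 2 - 1) l) = l"
    using assms by (intro degree_jacobi_poly) auto
  ultimately show ?thesis
    by (simp add: gegenbauer_poly_def Let_def poly_jacobi_poly_1)
qed

lemma gegenbauer_poly_orthogonal:
  assumes "d \<ge> 3" "degree p < l"
  shows "((\<lambda>t. (1 - t\<^sup>2) powr (real d / 2 - 1) * poly (gegenbauer_poly d l) t * poly p t)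
           has_integral 0) {-1..1}"
proof -
  let ?a = "real d / 2 - 1"
  define c where "c = 1 / poly (jacobi_poly ?a ?a l) 1"
  have "((\<lambda>x. (1 - x) powr ?a * (1 + x) powr ?a * poly (jacobi_poly ?a ?a l) x * poly p x)
           has_integral 0) {-1..1}"
    using assms by (intro jacobi_poly_orthogonal) auto
  from has_integral_mult_right[OF this, of c]
  have "((\<lambda>x. c * ((1 - x) powr ?a * (1 + x) powr ?a * poly (jacobi_poly ?a ?a l) x * poly p x))
           has_integral 0) {-1..1}" by simp
  thus ?thesis
  proof (rule has_integral_eq[rotated])
    fix x :: real assume "x \<in> {-1..1}"
    hence "((1 - x) * (1 + x)) powr ?a = (1 - x) powr ?a * (1 + x) powr ?a"
      by (simp add: powr_mult)
    moreover have "(1 - x) * (1 + x) = 1 - x\<^sup>2"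
      by (simp add: algebra_simps power2_eq_square)
    ultimately have "(1 - x) powr ?a * (1 + x) powr ?a = (1 - x\<^sup>2) powr ?a"
      by (simp only:)
    moreover have "poly (gegenbauer_poly d l) x = c * poly (jacobi_poly ?a ?a l) x"
      by (simp only: gegenbauer_poly_def Let_def c_def poly_smult)
    ultimately show "c * ((1 - x) powr ?a * (1 + x) powr ?a *
          poly (jacobi_poly ?a ?a l) x * poly p x)
        = (1 - x\<^sup>2) powr ?a * poly (gegenbauer_poly d l) x * poly p x"
      by (simp only: mult_ac)
  qed
qed


section \<open>Bessel functions of the first kind\<close>

text \<open>Real order, argument in [0, \<infinity>).  The reciprocal Gamma function covers the
  orders at which Gamma has poles.  The prefactor uses real powers, so for order 0 the value
  at the single point 0 is 0 instead of 1.\<close>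

definition bessel_J :: "real \<Rightarrow> real \<Rightarrow> real" where
  "bessel_J \<nu> x =
     (x / 2) powr \<nu> * (\<Sum>m. (-1) ^ m / fact m * rGamma (real m + \<nu> + 1) * (x / 2) ^ (2 * m))"


section \<open>Improper integrals over the half-line\<close>

definition improper_integrable :: "(real \<Rightarrow> real) \<Rightarrow> bool" where
  "improper_integrable f \<longleftrightarrow>
     (\<forall>R\<ge>0. f integrable_on {0..R}) \<and>
     (\<exists>L. ((\<lambda>R. integral {0..R} f) \<longlongrightarrow> L) at_top)"

definition improper_integral :: "(real \<Rightarrow> real) \<Rightarrow> real" where
  "improper_integral f = Lim at_top (\<lambda>R. integral {0..R} f)"

text \<open>Absolute integrability below is Lebesgue integrability on the whole half-line.\<close>

definition conditionally_convergent :: "(real \<Rightarrow> real) \<Rightarrow> bool" where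
  "conditionally_convergent f \<longleftrightarrow>
     improper_integrable f \<and> \<not> f absolutely_integrable_on {0..}"


section \<open>The constants\<close>

definition bessel_integrand :: "nat \<Rightarrow> nat \<Rightarrow> real \<Rightarrow> real" where
  "bessel_integrand q d \<psi> =
     bessel_J (real d / 2 - 1) \<psi> ^ q * \<psi> powr (- real q * (real d / 2 - 1) + real d - 1)"

definition gegenbauer_const :: "nat \<Rightarrow> nat \<Rightarrow> real" where
  "gegenbauer_const q d =
     (2 powr (real d / 2 - 1) * Gamma (real d / 2)) ^ q * improper_integral (bessel_integrand q d)"

end

(* Write Phi(x) = 2^nu Gamma(d/2) J_nu(x) x^(-nu) with nu = d/2 - 1.  After the substitution
   theta = x/l the Gegenbauer integrand converges pointwise to Phi^q x^(d-1) (Mehler-Heine, from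
   the hypergeometric expansion at 1 and Tannery's theorem).  With kappa = (d-1)/2, Sonin's
   monotone energy for sin^kappa(theta) G(cos theta), started at sin theta = 2 kappa / l, gives
   |G(cos theta)| <= C (l theta)^(-kappa); this yields a dominating function unless d = q = 3.
   In that case sin(theta) G(cos theta) = sin((l+1) theta)/(l+1), and the integral reduces to
   the integrals of sin(n theta)/sin(theta), which are evaluated by a recurrence and the Leibniz
   series.

   A multiplicative error 1 + o(1) makes sense only if the constant is nonzero, and for odd q
   this is not obvious.  The function y = x^kappa Phi satisfies
   y'' + (1 - kappa(kappa-1)/x^2) y = 0 with increasing potential, so by Sturm comparison each
   arch, reflected in its right endpoint, dominates the next one.  As the integrand equals
   y^q x^(-(q-2) kappa), its arch integrals alternate in sign and strictly decrease. *)

theory Submission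
  imports Defs "HOL-Probability.Sinc_Integral"
begin

text \<open>Every estimate on Phi is inherited from the Gegenbauer side: the bounds 1 and C (l
  theta)^(-\<kappa>) have constants independent of l, so the Mehler-Heine limit carries them over
  and no asymptotics of Bessel functions enter. The Bessel integrand is then O(x^(-\<kappa> (q-2))).
  For q, d >= 3 the condition \<kappa> (q-2) > 1 fails only at d = q = 3, where the exponent is
  exactly 1, so only this pair escapes dominated convergence. There both limits are computed and
  equal pi/4.

  Positivity is derived from the existence of the improper integral alone, so it covers the
  conditionally convergent case too. For d = 3 the potential is constant and all arches of y are
  congruent; the strict decrease of the arch integrals must therefore come from the weight x^(-(q-2)
  \<kappa>), and Sturm comparison need only give a weak inequality. No knowledge of zeros is
  presupposed: either Phi has no positive zero, and then the integrand is nonnegative, or there is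
  one, and comparison produces all later ones.\<close>

section \<open>Gegenbauer polynomials: expansion at 1 and differential equation\<close>

text \<open>Up to the sign (-1)^k this is the k-th coefficient of 2F1(-l, l+d-1; d/2; .), taken in
  powers of (t-1)/2. The factor j = l vanishes, so the series terminates by itself; the product form
  allows a limit factor by factor in \<open>mehler_heine_gegenbauer\<close>.\<close>

definition gegenbauer_coeff :: "nat \<Rightarrow> nat \<Rightarrow> nat \<Rightarrow> real" where
  "gegenbauer_coeff d l k =
     (\<Prod>j<k. (real l - real j) * (real l + real d - 1 + real j) / ((real j + 1) * (real j + real d / 2)))"

lemma gegenbauer_coeff_Suc:
  assumes "d \<ge> 1"
  shows "(real k + 1) * (real k + real d / 2) * gegenbauer_coeff d l (Suc k) =
     (real l - real k) * (real l + real d - 1 + real k) * gegenbauer_coeff d l k"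
proof -
  have "real k + 1 \<noteq> 0" "real k + real d / 2 \<noteq> 0" using assms by linarith+
  thus ?thesis unfolding gegenbauer_coeff_def prod.lessThan_Suc by (simp only: times_divide_eq_right nonzero_mult_div_cancel_left mult_eq_0_iff mult_ac)
     simp
qed

lemma gegenbauer_coeff_eq_0: "k > l \<Longrightarrow> gegenbauer_coeff d l k = 0"
  unfolding gegenbauer_coeff_def by (rule prod_zero) auto

text \<open>With u = (x-1)/2 the other factor is (u+1)^(n-s). After its binomial expansion,
  trinomial revision frees the first binomial coefficient of the index s, and Vandermonde sums over
  s.\<close>

lemma poly_jacobi_poly_expand_at_1:
  "poly (jacobi_poly \<alpha> \<beta> n) x =
     (\<Sum>k\<le>n. ((real n + \<alpha>) gchoose (n - k)) * ((real n + \<alpha> + \<beta> + real k) gchoose k) * ((x - 1) / 2) ^ k)"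
proof -
  define u where "u = (x - 1) / 2"
  have v: "(x + 1) / 2 = u + 1" by (simp add: u_def field_simps)
  have binom: "(u + 1) ^ (n - s) = (\<Sum>k\<in>{s..n}. real (n - s choose (n - k)) * u ^ (k - s))" if "s \<le> n" for s
  proof -
    have "(u + 1) ^ (n - s) = (\<Sum>k\<le>n - s. real (n - s choose k) * u ^ k)"
      by (simp add: binomial_ring)
    also have "\<dots> = (\<Sum>k\<in>{s..n}. real (n - s choose (n - k)) * u ^ (k - s))"
    proof (intro sum.reindex_bij_witness[of _ "\<lambda>k. k - s" "\<lambda>k. k + s"])
      fix k assume k: "k \<in> {..n - s}"
      hence "n - s choose k = (n - s choose (n - s - k))" by (intro binomial_symmetric) auto
      thus "real (n - s choose (n - (k + s))) * u ^ (k + s - s) = real (n - s choose k) * u ^ k"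
        by (simp add: diff_diff_eq add.commute)
    qed (use that in auto)
    finally show ?thesis .
  qed
  have "poly (jacobi_poly \<alpha> \<beta> n) x =
     (\<Sum>s\<le>n. \<Sum>k\<in>{s..n}. ((real n + \<alpha>) gchoose (n - s)) * ((real n + \<beta>) gchoose s) *
        (u ^ s * (real (n - s choose (n - k)) * u ^ (k - s))))"
    unfolding poly_jacobi_poly v u_def[symmetric]
    by (intro sum.cong refl) (simp add: binom sum_distrib_left)
  also have "\<dots> = (\<Sum>s\<le>n. \<Sum>k\<in>{s..n}. ((real n + \<alpha>) gchoose (n - k)) * u ^ k *
        (((real n + \<beta>) gchoose s) * ((\<alpha> + real k) gchoose (k - s))))"
  proof (intro sum.cong refl)
    fix s k assume "s \<in> {..n}" "k \<in> {s..n}"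
    hence sk: "s \<le> k" "k \<le> n" by auto
    have "((real n + \<alpha>) gchoose (n - s)) * real (n - s choose (n - k)) =
        ((real n + \<alpha>) gchoose (n - k)) * ((real n + \<alpha> - real (n - k)) gchoose (n - s - (n - k)))"
      using sk by (subst gbinomial_trinomial_revision[symmetric]) (auto simp: binomial_gbinomial)
    also have "real n + \<alpha> - real (n - k) = \<alpha> + real k" using sk by (simp add: of_nat_diff)
    also have "n - s - (n - k) = k - s" using sk by simp
    finally have e: "((real n + \<alpha>) gchoose (n - s)) * real (n - s choose (n - k)) =
      ((real n + \<alpha>) gchoose (n - k)) * ((\<alpha> + real k) gchoose (k - s))" .
    have p: "u ^ s * u ^ (k - s) = u ^ k" using sk by (simp flip: power_add)
    have "((real n + \<alpha>) gchoose (n - s)) * ((real n + \<beta>) gchoose s) *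
        (u ^ s * (real (n - s choose (n - k)) * u ^ (k - s)))
      = (((real n + \<alpha>) gchoose (n - s)) * real (n - s choose (n - k))) * ((real n + \<beta>) gchoose s) * (u ^ s * u ^ (k - s))"
      by (simp only: mult_ac)
    thus "((real n + \<alpha>) gchoose (n - s)) * ((real n + \<beta>) gchoose s) *
        (u ^ s * (real (n - s choose (n - k)) * u ^ (k - s)))
       = ((real n + \<alpha>) gchoose (n - k)) * u ^ k *
        (((real n + \<beta>) gchoose s) * ((\<alpha> + real k) gchoose (k - s)))"
      unfolding e p by (simp only: mult_ac)
  qed
  also have "\<dots> = (\<Sum>k\<le>n. \<Sum>s\<le>k. ((real n + \<alpha>) gchoose (n - k)) * u ^ k *
        (((real n + \<beta>) gchoose s) * ((\<alpha> + real k) gchoose (k - s))))"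
    unfolding sum.Sigma[OF finite_atMost ballI[OF finite_atLeastAtMost]] sum.Sigma[OF finite_atMost ballI[OF finite_atMost]]
    by (intro sum.reindex_bij_witness[of _ "\<lambda>(k,s). (s,k)" "\<lambda>(s,k). (k,s)"]) auto
  also have "\<dots> = (\<Sum>k\<le>n. ((real n + \<alpha>) gchoose (n - k)) * u ^ k * ((real n + \<alpha> + \<beta> + real k) gchoose k))"
  proof (intro sum.cong refl)
    fix k
    have "(\<Sum>s\<le>k. ((real n + \<beta>) gchoose s) * ((\<alpha> + real k) gchoose (k - s))) = (real n + \<beta> + (\<alpha> + real k)) gchoose k"
      using gbinomial_Vandermonde[of "real n + \<beta>" "\<alpha> + real k" k] by (simp add: atLeast0AtMost)
    thus "(\<Sum>s\<le>k. ((real n + \<alpha>) gchoose (n - k)) * u ^ k *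
        (((real n + \<beta>) gchoose s) * ((\<alpha> + real k) gchoose (k - s))))
       = ((real n + \<alpha>) gchoose (n - k)) * u ^ k * ((real n + \<alpha> + \<beta> + real k) gchoose k)"
      unfolding sum_distrib_left[symmetric] by (simp add: add_ac)
  qed
  finally show ?thesis by (simp add: u_def mult_ac)
qed

text \<open>Normalizing at t = 1 means dividing by the constant term \<open>A 0\<close>; the ratios
  \<open>A k / A 0\<close> and \<open>gegenbauer_coeff\<close> obey the same two-term
  recurrence.\<close>

lemma poly_gegenbauer_poly_expand_at_1:
  assumes "d \<ge> 1"
  shows "poly (gegenbauer_poly d l) t = (\<Sum>k\<le>l. gegenbauer_coeff d l k * ((t - 1) / 2) ^ k)"
proof -
  define \<alpha> where "\<alpha> = real d / 2 - 1"
  define A where "A k = ((real l + \<alpha>) gchoose (l - k)) * ((real l + \<alpha> + \<alpha> + real k) gchoose k)" for k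
  have A0: "A 0 > 0"
    using assms by (simp add: A_def \<alpha>_def) (intro gbinomial_pos, auto)
  have step: "(real k + 1) * (real k + real d / 2) * A (Suc k) = (real l - real k) * (real l + real d - 1 + real k) * A k"
    if "k < l" for k
  proof -
    define m where "m = l - Suc k"
    have m: "l - k = Suc m" "l - Suc k = m" "real m = real l - real k - 1" using that by (auto simp: m_def of_nat_diff)
    have 1: "(real k + real d / 2) * ((real l + \<alpha>) gchoose m) = (real l - real k) * ((real l + \<alpha>) gchoose Suc m)"
      using gbinomial_step[of "real l + \<alpha>" m] by (simp add: m(3) \<alpha>_def algebra_simps)
    have "real (Suc k) * ((real l + \<alpha> + \<alpha> + real (Suc k)) gchoose Suc k)
        = (real l + \<alpha> + \<alpha> + real (Suc k)) * ((real l + \<alpha> + \<alpha> + real (Suc k) - 1) gchoose k)"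
      by (rule gbinomial_absorption)
    also have "real l + \<alpha> + \<alpha> + real (Suc k) - 1 = real l + \<alpha> + \<alpha> + real k" by simp
    finally have 2: "(real k + 1) * ((real l + \<alpha> + \<alpha> + real (Suc k)) gchoose Suc k)
        = (real l + real d - 1 + real k) * ((real l + \<alpha> + \<alpha> + real k) gchoose k)"
      by (simp add: \<alpha>_def add_ac)
    show ?thesis
      unfolding A_def m using arg_cong2[OF 1 2, of "(*)"] by (simp only: mult_ac)
  qed
  have A: "A k / A 0 = gegenbauer_coeff d l k" if "k \<le> l" for k
    using that
  proof (induction k)
    case 0
    show ?case using A0 by (simp add: gegenbauer_coeff_def)
  next
    case (Suc k)
    have pos: "(real k + 1) * (real k + real d / 2) > 0" using assms by (intro mult_pos_pos) auto
    have "(real k + 1) * (real k + real d / 2) * (A (Suc k) / A 0)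
        = (real l - real k) * (real l + real d - 1 + real k) * (A k / A 0)"
      using step[of k] Suc.prems by simp
    also have "\<dots> = (real k + 1) * (real k + real d / 2) * gegenbauer_coeff d l (Suc k)"
      using Suc gegenbauer_coeff_Suc[OF assms, of k l] by simp
    finally show ?case using pos by (metis less_irrefl mult_left_cancel)
  qed
  have "poly (jacobi_poly \<alpha> \<alpha> l) 1 = A 0" by (simp add: poly_jacobi_poly_1 A_def)
  hence "poly (gegenbauer_poly d l) t = 1 / A 0 * (\<Sum>k\<le>l. A k * ((t - 1) / 2) ^ k)"
    unfolding gegenbauer_poly_def Let_def \<alpha>_def[symmetric] poly_smult
    by (simp only: poly_jacobi_poly_expand_at_1 A_def)
  also have "\<dots> = (\<Sum>k\<le>l. A k / A 0 * ((t - 1) / 2) ^ k)"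
    by (simp add: sum_divide_distrib)
  finally show ?thesis using A by simp
qed

text \<open>In u = (t-1)/2 the coefficient recurrence is the hypergeometric equation u(u+1)P'' +
  (d/2)(2u+1)P' = NP, and u = (cos theta - 1)/2 gives the stated form. The factor sin theta makes it
  valid for every theta; \<open>g1 0 = 0\<close> supplies what the equation does not show at
  0.\<close>

lemma gegenbauer_ode:
  assumes "d \<ge> 1"
  obtains g1 g2 where
    "\<And>\<theta>. ((\<lambda>\<theta>. poly (gegenbauer_poly d l) (cos \<theta>)) has_real_derivative g1 \<theta>) (at \<theta>)"
    "\<And>\<theta>. (g1 has_real_derivative g2 \<theta>) (at \<theta>)"
    "\<And>\<theta>. sin \<theta> * g2 \<theta> + (real d - 1) * cos \<theta> * g1 \<theta>
        + real l * (real l + real d - 1) * sin \<theta> * poly (gegenbauer_poly d l) (cos \<theta>) = 0"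
    "g1 0 = 0"
proof -
  define N where "N = real l * (real l + real d - 1)"
  define P where "P = (\<Sum>k\<le>l. monom (gegenbauer_coeff d l k) k)"
  have coeff: "coeff P k = gegenbauer_coeff d l k" for k
  proof -
    have "coeff P k = (\<Sum>j\<le>l. if j = k then gegenbauer_coeff d l k else 0)"
      unfolding P_def coeff_sum by (intro sum.cong) auto
    thus ?thesis by (auto simp: gegenbauer_coeff_eq_0)
  qed
  define D where "D = real d / 2"
  have dD: "real d = 2 * D" "real d / 2 = D" and N: "N = real l * (real l + 2 * D - 1)"
    by (simp_all add: D_def N_def)
  have rec: "(real k + 1) * (real k + D) * gegenbauer_coeff d l (Suc k) =
     (real l - real k) * (real l + 2 * D - 1 + real k) * gegenbauer_coeff d l k" for k
    using gegenbauer_coeff_Suc[OF assms, of k l] by (simp add: dD)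
  have ode: "pCons 0 (pCons 0 (pderiv (pderiv P))) + pCons 0 (pderiv (pderiv P))
      + smult (real d / 2) (pderiv P) + smult (real d) (pCons 0 (pderiv P)) = smult N P"
  proof (rule poly_eqI)
    fix k
    show "coeff (pCons 0 (pCons 0 (pderiv (pderiv P))) + pCons 0 (pderiv (pderiv P))
      + smult (real d / 2) (pderiv P) + smult (real d) (pCons 0 (pderiv P))) k = coeff (smult N P) k"
      using rec[of k]
      by (auto simp: coeff_pCons coeff_pderiv coeff algebra_simps N dD split: nat.splits)
  qed
  have G: "poly (gegenbauer_poly d l) t = poly P ((t - 1) / 2)" for t
    by (simp add: poly_gegenbauer_poly_expand_at_1[OF assms] P_def poly_sum poly_monom)
  define u where "u \<theta> = (cos \<theta> - 1) / 2" for \<theta> :: real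
  define g1 where "g1 \<theta> = poly (pderiv P) (u \<theta>) * (- sin \<theta> / 2)" for \<theta>
  define g2 where "g2 \<theta> = poly (pderiv (pderiv P)) (u \<theta>) * (- sin \<theta> / 2) * (- sin \<theta> / 2)
      + poly (pderiv P) (u \<theta>) * (- cos \<theta> / 2)" for \<theta>
  have u: "(u has_real_derivative - sin \<theta> / 2) (at \<theta>)" for \<theta>
    unfolding u_def by (auto intro!: derivative_eq_intros)
  have du: "((\<lambda>\<theta>. poly q (u \<theta>)) has_real_derivative poly (pderiv q) (u \<theta>) * (- sin \<theta> / 2)) (at \<theta>)" for q \<theta>
    by (rule DERIV_chain2[OF poly_DERIV u])
  show ?thesis
  proof (rule that)
    fix \<theta> :: real
    show "((\<lambda>\<theta>. poly (gegenbauer_poly d l) (cos \<theta>)) has_real_derivative g1 \<theta>) (at \<theta>)"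
      unfolding G u_def[symmetric] g1_def by (rule du)
    show "(g1 has_real_derivative g2 \<theta>) (at \<theta>)"
      unfolding g1_def g2_def by (rule DERIV_cong[OF DERIV_mult[OF du]]) (auto intro!: derivative_eq_intros)
    have "poly (pCons 0 (pCons 0 (pderiv (pderiv P))) + pCons 0 (pderiv (pderiv P))
      + smult (real d / 2) (pderiv P) + smult (real d) (pCons 0 (pderiv P))) (u \<theta>) = poly (smult N P) (u \<theta>)"
      by (simp only: ode)
    hence *: "u \<theta> * (u \<theta> + 1) * poly (pderiv (pderiv P)) (u \<theta>) + real d / 2 * (2 * u \<theta> + 1) * poly (pderiv P) (u \<theta>)
        = N * poly P (u \<theta>)"
      by (simp add: algebra_simps)
    have u1: "u \<theta> * (u \<theta> + 1) = - (sin \<theta> * sin \<theta>) / 4" "2 * u \<theta> + 1 = cos \<theta>"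
      using sin_cos_squared_add[of \<theta>] by (auto simp: u_def field_simps power2_eq_square)
    have "sin \<theta> * g2 \<theta> + (real d - 1) * cos \<theta> * g1 \<theta> + N * sin \<theta> * poly P (u \<theta>)
      = sin \<theta> * (N * poly P (u \<theta>) - (- (sin \<theta> * sin \<theta>) / 4 * poly (pderiv (pderiv P)) (u \<theta>) + real d / 2 * cos \<theta> * poly (pderiv P) (u \<theta>)))"
      by (simp add: g1_def g2_def field_simps)
    also have "\<dots> = 0" using * unfolding u1 by simp
    finally show "sin \<theta> * g2 \<theta> + (real d - 1) * cos \<theta> * g1 \<theta>
        + real l * (real l + real d - 1) * sin \<theta> * poly (gegenbauer_poly d l) (cos \<theta>) = 0"
      by (simp add: G u_def N_def)
    show "g1 0 = 0" by (simp add: g1_def)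
  qed
qed

text \<open>The energy g^2 + g'^2/N has derivative -2(d-1) cot(theta) g'^2/N, which is nonpositive
  while cos theta >= 0, and it starts at 1. The bound on the derivative provides the initial data in
  \<open>gegenbauer_decay\<close>.\<close>

lemma gegenbauer_bounds:
  assumes "d \<ge> 1" "l \<ge> 1" "0 \<le> \<theta>" "\<theta> \<le> pi / 2"
    and D: "((\<lambda>\<theta>. poly (gegenbauer_poly d l) (cos \<theta>)) has_real_derivative D) (at \<theta>)"
  shows "(poly (gegenbauer_poly d l) (cos \<theta>))\<^sup>2 + D\<^sup>2 / (real l * (real l + real d - 1)) \<le> 1"
proof -
  define N where "N = real l * (real l + real d - 1)"
  have N: "N > 0" using assms by (auto simp: N_def intro!: mult_pos_pos)
  define g where "g \<theta> = poly (gegenbauer_poly d l) (cos \<theta>)" for \<theta>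
  obtain g1 g2 where g: "\<And>\<theta>. (g has_real_derivative g1 \<theta>) (at \<theta>)"
      and g1: "\<And>\<theta>. (g1 has_real_derivative g2 \<theta>) (at \<theta>)"
      and ode: "\<And>\<theta>. sin \<theta> * g2 \<theta> + (real d - 1) * cos \<theta> * g1 \<theta> + N * sin \<theta> * g \<theta> = 0"
      and g10: "g1 0 = 0"
    using gegenbauer_ode[OF \<open>d \<ge> 1\<close>, of l] unfolding g_def N_def by metis
  define E where "E \<theta> = (g \<theta>)\<^sup>2 + (g1 \<theta>)\<^sup>2 / N" for \<theta>
  have "E \<theta> \<le> E 0"
  proof (rule DERIV_nonpos_imp_nonincreasing[OF \<open>0 \<le> \<theta>\<close>])
    fix x assume x: "0 \<le> x" "x \<le> \<theta>"
    let ?D = "2 * g x * g1 x + 2 * g1 x * g2 x / N"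
    have "(E has_real_derivative ?D) (at x)"
      unfolding E_def using N by (auto intro!: derivative_eq_intros g g1)
    moreover have "?D \<le> 0"
    \<comment> \<open>The equation degenerates at 0, where the derivative of \<open>E\<close>
      vanishes because of \<open>g1 0 = 0\<close>; elsewhere its sign is read off after multiplying
      by sin x.\<close>
    proof (cases "x = 0")
      case False
      hence s: "sin x > 0" using x assms pi_gt_zero by (intro sin_gt_zero) auto
      have c: "cos x \<ge> 0" using x assms by (intro cos_ge_zero) auto
      have e: "sin x * g2 x = - ((real d - 1) * cos x * g1 x + N * sin x * g x)"
        using ode[of x] by linarith
      have "sin x * ?D = 2 * g1 x / N * (N * sin x * g x + sin x * g2 x)"
        using N by (simp add: field_simps)
      also have "\<dots> = - (2 * (real d - 1) * cos x * (g1 x)\<^sup>2 / N)"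
        unfolding e using N by (simp add: field_simps power2_eq_square)
      also have "\<dots> \<le> 0" using N c assms by simp
      finally show ?thesis using s by (simp add: mult_le_0_iff)
    qed (simp add: g10)
    ultimately show "\<exists>y. (E has_real_derivative y) (at x) \<and> y \<le> 0" by blast
  qed
  also have "E 0 = 1" using poly_gegenbauer_poly_1[OF \<open>d \<ge> 1\<close>] by (simp add: E_def g10 g_def)
  finally have "E \<theta> \<le> 1" .
  moreover have "D = g1 \<theta>" using DERIV_unique[OF D] g[of \<theta>] by (simp add: g_def[abs_def])
  ultimately show ?thesis by (simp add: E_def g_def N_def)
qed

lemma abs_gegenbauer_le_1:
  assumes "d \<ge> 1" "0 \<le> \<theta>" "\<theta> \<le> pi / 2"
  shows "\<bar>poly (gegenbauer_poly d l) (cos \<theta>)\<bar> \<le> 1"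
proof (cases "l = 0")
  case True
  thus ?thesis by (simp add: poly_gegenbauer_poly_expand_at_1[OF assms(1)] gegenbauer_coeff_def)
next
  case False
  obtain g1 where "((\<lambda>\<theta>. poly (gegenbauer_poly d l) (cos \<theta>)) has_real_derivative g1 \<theta>) (at \<theta>)"
    using gegenbauer_ode[OF \<open>d \<ge> 1\<close>, of l] by metis
  from gegenbauer_bounds[OF assms(1) _ assms(2,3) this] False
  have "(poly (gegenbauer_poly d l) (cos \<theta>))\<^sup>2 + (g1 \<theta>)\<^sup>2 / (real l * (real l + real d - 1)) \<le> 1" by simp
  moreover have "0 \<le> (g1 \<theta>)\<^sup>2 / (real l * (real l + real d - 1))" using assms False by (intro divide_nonneg_nonneg mult_nonneg_nonneg) auto
  ultimately show ?thesis by (intro abs_square_le_1[THEN iffD1]) linarith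
qed

section \<open>Decay of Gegenbauer polynomials\<close>

text \<open>For y'' = -\<phi> y the mixed terms in the derivative of y^2 + y'^2/\<phi> cancel, and
  only -y'^2 \<phi>'/\<phi>^2 is left.\<close>

lemma sonin_bound:
  fixes y y1 \<phi> \<phi>1 :: "real \<Rightarrow> real"
  assumes "a \<le> b"
    and y: "\<And>x. a \<le> x \<Longrightarrow> x \<le> b \<Longrightarrow> (y has_real_derivative y1 x) (at x)"
    and y1: "\<And>x. a \<le> x \<Longrightarrow> x \<le> b \<Longrightarrow> (y1 has_real_derivative - \<phi> x * y x) (at x)"
    and \<phi>: "\<And>x. a \<le> x \<Longrightarrow> x \<le> b \<Longrightarrow> (\<phi> has_real_derivative \<phi>1 x) (at x)"
    and pos: "\<And>x. a \<le> x \<Longrightarrow> x \<le> b \<Longrightarrow> \<phi> x > 0"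
    and incr: "\<And>x. a \<le> x \<Longrightarrow> x \<le> b \<Longrightarrow> \<phi>1 x \<ge> 0"
  shows "(y b)\<^sup>2 \<le> (y a)\<^sup>2 + (y1 a)\<^sup>2 / \<phi> a"
proof -
  define E where "E x = (y x)\<^sup>2 + (y1 x)\<^sup>2 / \<phi> x" for x
  have "E b \<le> E a"
  proof (rule DERIV_nonpos_imp_nonincreasing[OF \<open>a \<le> b\<close>])
    fix x assume x: "a \<le> x" "x \<le> b"
    have "(E has_real_derivative 2 * y x * y1 x + (2 * y1 x * (- \<phi> x * y x) * \<phi> x - (y1 x)\<^sup>2 * \<phi>1 x) / (\<phi> x * \<phi> x)) (at x)"
      unfolding E_def using pos[OF x] by (auto intro!: derivative_eq_intros y y1 \<phi> x)
    moreover have "2 * y x * y1 x + (2 * y1 x * (- \<phi> x * y x) * \<phi> x - (y1 x)\<^sup>2 * \<phi>1 x) / (\<phi> x * \<phi> x)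
       = - ((y1 x)\<^sup>2 * \<phi>1 x / (\<phi> x * \<phi> x))"
      using pos[OF x] by (simp add: field_simps)
    moreover have "(y1 x)\<^sup>2 * \<phi>1 x / (\<phi> x * \<phi> x) \<ge> 0" using incr[OF x] by simp
    ultimately show "\<exists>D. (E has_real_derivative D) (at x) \<and> D \<le> 0"
      by (metis neg_le_0_iff_le)
  qed
  moreover have "(y1 b)\<^sup>2 / \<phi> b \<ge> 0" using pos[of b] \<open>a \<le> b\<close> by simp
  ultimately show ?thesis unfolding E_def by linarith
qed

text \<open>The factor sin^\<kappa> removes the first-order term: y'' + \<phi> y = 0 with \<phi> =
  (l+\<kappa>)^2 - \<kappa>(\<kappa>-1)/sin^2, which is nondecreasing up to pi/2. Where l sin theta
  <= 2 \<kappa>, the right-hand side is at least 3 and the trivial bound 1 is enough.\<close>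

lemma gegenbauer_decay:
  assumes "d \<ge> 3" "l \<ge> 1" "0 < \<theta>" "\<theta> \<le> pi / 2"
  defines "\<kappa> \<equiv> (real d - 1) / 2"
  shows "\<bar>poly (gegenbauer_poly d l) (cos \<theta>)\<bar> \<le> 3 * (2 * \<kappa> / (real l * sin \<theta>)) powr \<kappa>"
proof (cases "real l * sin \<theta> \<le> 2 * \<kappa>")
  case True
  have "sin \<theta> > 0" using assms pi_gt_zero by (intro sin_gt_zero) auto
  hence "1 \<le> 2 * \<kappa> / (real l * sin \<theta>)" using True assms by simp
  hence "1 \<le> (2 * \<kappa> / (real l * sin \<theta>)) powr \<kappa>" using assms by (intro ge_one_powr_ge_zero) auto
  moreover have "\<bar>poly (gegenbauer_poly d l) (cos \<theta>)\<bar> \<le> 1"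
    using assms by (intro abs_gegenbauer_le_1) auto
  ultimately show ?thesis by linarith
next
  case False
  have lam: "\<kappa> \<ge> 1" "real d = 2 * \<kappa> + 1" using assms by (auto simp: \<kappa>_def field_simps)
  define L where "L = real l"
  have L: "L \<ge> 1" using assms by (simp add: L_def)
  \<comment> \<open>From sin = s on, the subtracted term of \<phi> is at most l^2/4, so \<phi> >= 3
    l^2/4, while at the starting point sin^\<kappa> is only s^\<kappa>.\<close>
  define s where "s = 2 * \<kappa> / L"
  have s: "s > 0" "s < sin \<theta>" using False lam L by (auto simp: s_def L_def field_simps)
  have s1: "s \<le> 1" using s(2) sin_le_one[of \<theta>] by linarith
  have lamL: "\<kappa> \<le> L / 2" "L = 2 * \<kappa> / s" using s1 L s lam by (auto simp: s_def field_simps)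
  define \<theta>0 where "\<theta>0 = arcsin s"
  have t0: "sin \<theta>0 = s" using s s1 by (simp add: \<theta>0_def)
  have t0b: "0 < \<theta>0" "\<theta>0 \<le> pi / 2" using s s1 arcsin_bounded[of s] arcsin_less_arcsin[of 0 s] by (auto simp: \<theta>0_def)
  have t0le: "\<theta>0 \<le> \<theta>"
  proof (rule ccontr)
    assume "\<not> \<theta>0 \<le> \<theta>"
    hence "sin \<theta> \<le> sin \<theta>0" using t0b assms by (intro sin_monotone_2pi_le) auto
    thus False using t0 s by simp
  qed
  \<comment> \<open>\<open>N\<close> is the eigenvalue l(l+d-1). The substitution raises it by
    \<kappa>^2, which completes the square to \<open>M\<close>.\<close>
  define N where "N = L * (L + 2 * \<kappa>)"
  define M where "M = (L + \<kappa>)\<^sup>2"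
  have NM: "M = N + \<kappa>\<^sup>2" by (simp add: M_def N_def power2_eq_square algebra_simps)
  have Npos: "N > 0" using L lam by (auto simp: N_def intro!: mult_pos_pos)
  define g where "g \<theta> = poly (gegenbauer_poly d l) (cos \<theta>)" for \<theta>
  have N_eq: "real l * (real l + real d - 1) = N" by (simp add: N_def L_def lam)
  have d1: "d \<ge> 1" using assms(1) by simp
  have k2: "real d - 1 = 2 * \<kappa>" by (simp add: lam)
  obtain g1 g2 where g: "\<And>\<theta>. (g has_real_derivative g1 \<theta>) (at \<theta>)"
      and g1: "\<And>\<theta>. (g1 has_real_derivative g2 \<theta>) (at \<theta>)"
      and ode: "\<And>\<theta>. sin \<theta> * g2 \<theta> + 2 * \<kappa> * cos \<theta> * g1 \<theta> + N * sin \<theta> * g \<theta> = 0"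
    using gegenbauer_ode[of d l, unfolded N_eq k2] d1 unfolding g_def by metis
  have bound0: "(g \<theta>0)\<^sup>2 + (g1 \<theta>0)\<^sup>2 / N \<le> 1"
    using gegenbauer_bounds[of d l \<theta>0 "g1 \<theta>0"] g[of \<theta>0] assms t0b unfolding g_def[abs_def] N_eq by auto
  define \<phi> where "\<phi> x = M - \<kappa> * (\<kappa> - 1) / (sin x)\<^sup>2" for x
  define y where "y x = sin x powr \<kappa> * g x" for x
  define y1 where "y1 x = \<kappa> * sin x powr (\<kappa> - 1) * cos x * g x + sin x powr \<kappa> * g1 x" for x
  have sinx: "s \<le> sin x" "0 < sin x" if "\<theta>0 \<le> x" "x \<le> \<theta>" for x
  proof -
    have "sin \<theta>0 \<le> sin x" using that t0b assms by (intro sin_monotone_2pi_le) auto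
    thus "s \<le> sin x" "0 < sin x" using t0 s by auto
  qed
  have phi_ge: "\<phi> x \<ge> 3 / 4 * L\<^sup>2" if "\<theta>0 \<le> x" "x \<le> \<theta>" for x
  proof -
    have "\<kappa> * (\<kappa> - 1) / (sin x)\<^sup>2 \<le> \<kappa> * \<kappa> / s\<^sup>2"
      using sinx[OF that] s lam by (intro frac_le mult_mono power_mono mult_nonneg_nonneg) auto
    also have "\<dots> = L\<^sup>2 / 4" using s lam by (simp add: lamL(2) field_simps power2_eq_square)
    finally have "\<kappa> * (\<kappa> - 1) / (sin x)\<^sup>2 \<le> L\<^sup>2 / 4" .
    moreover have "M \<ge> L\<^sup>2" unfolding M_def using L lam by (intro power_mono) auto
    ultimately show ?thesis unfolding \<phi>_def by linarith
  qed
  have "(y \<theta>)\<^sup>2 \<le> (y \<theta>0)\<^sup>2 + (y1 \<theta>0)\<^sup>2 / \<phi> \<theta>0"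
  proof (rule sonin_bound[OF t0le])
    fix x assume x: "\<theta>0 \<le> x" "x \<le> \<theta>"
    note sx = sinx[OF x]
    have cx: "cos x \<ge> 0" using x t0b assms by (intro cos_ge_zero) auto
    have pw: "((\<lambda>x. sin x powr r) has_real_derivative r * sin x powr (r - 1) * cos x) (at x)" for r
      using DERIV_fun_powr[OF DERIV_sin sx(2), of r] by simp
    have p1: "sin x powr \<kappa> = sin x powr (\<kappa> - 1 - 1) * (sin x * sin x)" "sin x powr (\<kappa> - 1) = sin x powr (\<kappa> - 1 - 1) * sin x"
      using sx by (simp_all add: powr_diff field_simps power2_eq_square)
    show "(y has_real_derivative y1 x) (at x)"
      unfolding y_def y1_def by (rule DERIV_cong[OF DERIV_mult[OF pw g]]) (simp add: mult_ac)
    \<comment> \<open>With this lowest power factored out, y'' = -\<phi> y becomes an algebraic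
      identity in sin, cos, g and its derivatives.\<close>
    define p where "p = sin x powr (\<kappa> - 1 - 1)"
    have "(y1 has_real_derivative \<kappa> * ((\<kappa> - 1) * p * cos x) * cos x * g x
        + \<kappa> * sin x powr (\<kappa> - 1) * (- sin x) * g x + \<kappa> * sin x powr (\<kappa> - 1) * cos x * g1 x
        + \<kappa> * sin x powr (\<kappa> - 1) * cos x * g1 x + sin x powr \<kappa> * g2 x) (at x)"
      unfolding y1_def p_def by (auto intro!: derivative_eq_intros pw g g1 simp: algebra_simps sx)
    also have "\<kappa> * ((\<kappa> - 1) * p * cos x) * cos x * g x
        + \<kappa> * sin x powr (\<kappa> - 1) * (- sin x) * g x + \<kappa> * sin x powr (\<kappa> - 1) * cos x * g1 x
        + \<kappa> * sin x powr (\<kappa> - 1) * cos x * g1 x + sin x powr \<kappa> * g2 x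
      = p * (\<kappa> * (\<kappa> - 1) * (cos x)\<^sup>2 * g x - \<kappa> * (sin x)\<^sup>2 * g x + sin x * (sin x * g2 x + 2 * \<kappa> * cos x * g1 x))"
      unfolding p1 p_def[symmetric] by (simp add: algebra_simps power2_eq_square)
    also have "sin x * g2 x + 2 * \<kappa> * cos x * g1 x = - (N * sin x * g x)"
      using ode[of x] by linarith
    also have "p * (\<kappa> * (\<kappa> - 1) * (cos x)\<^sup>2 * g x - \<kappa> * (sin x)\<^sup>2 * g x + sin x * (- (N * sin x * g x))) = - \<phi> x * y x"
      unfolding \<phi>_def y_def p1 p_def[symmetric] NM cos_squared_eq using sx
      by (simp add: field_simps power2_eq_square)
    finally show "(y1 has_real_derivative - \<phi> x * y x) (at x)" .
    show "(\<phi> has_real_derivative 2 * \<kappa> * (\<kappa> - 1) * cos x / (sin x) ^ 3) (at x)"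
      unfolding \<phi>_def using sx
      by (auto intro!: derivative_eq_intros simp: field_simps power2_eq_square power3_eq_cube)
    show "0 \<le> 2 * \<kappa> * (\<kappa> - 1) * cos x / (sin x) ^ 3"
      using sx cx lam by simp
    have "L\<^sup>2 > 0" using L by simp
    thus "\<phi> x > 0" using phi_ge[OF x] by linarith
  qed
  \<comment> \<open>9 = 1 + 8: the first term is at most s^(2 \<kappa>), the second at most 4 l^2 /
    (3 l^2/4) = 16/3 <= 8 times that.\<close>
  also have "\<dots> \<le> 9 * (s powr \<kappa>)\<^sup>2"
  proof -
    have gg: "\<bar>g \<theta>0\<bar> \<le> 1" using t0b assms unfolding g_def by (intro abs_gegenbauer_le_1) auto
    have a: "(y \<theta>0)\<^sup>2 \<le> (s powr \<kappa>)\<^sup>2"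
      unfolding y_def t0 power_mult_distrib using gg by (intro mult_right_le_one_le) (auto simp: abs_square_le_1)
    have "(g1 \<theta>0)\<^sup>2 \<le> N"
      using bound0 Npos zero_le_power2[of "g \<theta>0"] by (simp add: field_simps) (smt (verit) mult_nonneg_nonneg zero_le_power2)
    also have "N \<le> (L + \<kappa>)\<^sup>2" using NM M_def by simp
    finally have g1b: "\<bar>g1 \<theta>0\<bar> \<le> L + \<kappa>" using L lam by (simp add: abs_le_square_iff[symmetric])
    have e: "s powr (\<kappa> - 1) = s powr \<kappa> / s" using s by (simp add: powr_diff)
    \<comment> \<open>The factor 2l below is the sum of \<kappa>/s = l/2 and of l + \<kappa> <=
      3l/2, the latter from the energy bound on \<open>g1\<close>.\<close>
    have "y1 \<theta>0 = s powr \<kappa> * (\<kappa> / s * (cos \<theta>0 * g \<theta>0) + g1 \<theta>0)"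
      unfolding y1_def t0 e by (simp add: field_simps)
    also have "\<bar>\<dots>\<bar> \<le> s powr \<kappa> * (2 * L)"
    proof -
      have "\<bar>cos \<theta>0 * g \<theta>0\<bar> \<le> 1" using gg by (simp add: abs_mult mult_le_one)
      hence "\<bar>\<kappa> / s * (cos \<theta>0 * g \<theta>0)\<bar> \<le> \<kappa> / s * 1"
        unfolding abs_mult using lam s by (intro mult_mono) auto
      also have "\<kappa> / s * 1 = L / 2" using lamL by simp
      finally have "\<bar>\<kappa> / s * (cos \<theta>0 * g \<theta>0) + g1 \<theta>0\<bar> \<le> 2 * L"
        using g1b lamL(1) by linarith
      thus ?thesis by (simp add: abs_mult mult_left_mono)
    qed
    finally have "(y1 \<theta>0)\<^sup>2 \<le> (s powr \<kappa> * (2 * L))\<^sup>2"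
      using L by (simp add: abs_le_square_iff[symmetric] abs_mult)
    hence "(y1 \<theta>0)\<^sup>2 / \<phi> \<theta>0 \<le> (s powr \<kappa> * (2 * L))\<^sup>2 / (3 / 4 * L\<^sup>2)"
      using phi_ge[of \<theta>0] t0le L by (intro frac_le) auto
    also have "\<dots> \<le> 8 * (s powr \<kappa>)\<^sup>2" using L by (simp add: field_simps)
    finally show ?thesis using a by linarith
  qed
  also have "\<dots> = (3 * s powr \<kappa>)\<^sup>2" by (simp add: power_mult_distrib)
  finally have "\<bar>y \<theta>\<bar> \<le> \<bar>3 * s powr \<kappa>\<bar>" by (simp only: abs_le_square_iff)
  hence "\<bar>y \<theta>\<bar> \<le> 3 * s powr \<kappa>" by simp
  moreover have st: "sin \<theta> > 0" using s by linarith
  ultimately have "\<bar>g \<theta>\<bar> \<le> 3 * s powr \<kappa> / sin \<theta> powr \<kappa>"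
    by (simp add: y_def abs_mult field_simps)
  also have "\<dots> = 3 * (s / sin \<theta>) powr \<kappa>" using st s by (simp add: powr_divide)
  also have "s / sin \<theta> = 2 * \<kappa> / (real l * sin \<theta>)" by (simp add: s_def L_def)
  finally show ?thesis by (simp add: g_def)
qed

section \<open>Normalized Bessel functions and the Mehler-Heine limit\<close>

definition bessel_coeff :: "nat \<Rightarrow> nat \<Rightarrow> real" where
  "bessel_coeff d m = (- 1) ^ m / (4 ^ m * fact m * pochhammer (real d / 2) m)"

text \<open>Phi as the series 0F1(; d/2; -x^2/4): entire and even, so that no real power of x
  interferes at 0.\<close>

definition bessel_normalized :: "nat \<Rightarrow> real \<Rightarrow> real" where
  "bessel_normalized d x = (\<Sum>m. bessel_coeff d m * (x\<^sup>2) ^ m)"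

lemma pochhammer_ge_1:
  fixes a :: real
  assumes "a \<ge> 1"
  shows "pochhammer a m \<ge> 1"
  unfolding pochhammer_prod using assms by (intro prod_ge_1) auto

lemma summable_bessel_coeff:
  assumes "d \<ge> 2"
  shows "summable (\<lambda>m. bessel_coeff d m * y ^ m)"
proof (rule summable_comparison_test'[OF summable_exp[of "\<bar>y\<bar>"]])
  fix m :: nat
  have "1 * fact m * 1 \<le> 4 ^ m * fact m * pochhammer (real d / 2) m"
    using assms by (intro mult_mono pochhammer_ge_1) auto
  hence "1 / (4 ^ m * fact m * pochhammer (real d / 2) m) \<le> 1 / fact m"
    using assms pochhammer_pos[of "real d / 2" m] by (intro divide_left_mono) auto
  moreover have "\<bar>bessel_coeff d m\<bar> = 1 / (4 ^ m * fact m * pochhammer (real d / 2) m)"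
    using assms pochhammer_pos[of "real d / 2" m] by (simp add: bessel_coeff_def abs_mult power_abs)
  ultimately have "\<bar>bessel_coeff d m\<bar> * \<bar>y\<bar> ^ m \<le> 1 / fact m * \<bar>y\<bar> ^ m"
    by (intro mult_right_mono) auto
  thus "norm (bessel_coeff d m * y ^ m) \<le> inverse (fact m) * \<bar>y\<bar> ^ m"
    by (simp add: abs_mult power_abs inverse_eq_divide)
qed

lemma bessel_normalized_0 [simp]: "bessel_normalized d 0 = 1"
proof -
  have "bessel_normalized d 0 = (\<Sum>m. bessel_coeff d m * 0 ^ m)" by (simp add: bessel_normalized_def)
  also have "\<dots> = bessel_coeff d 0" by (rule powser_zero)
  finally show ?thesis by (simp add: bessel_coeff_def)
qed

text \<open>In s = x^2 the coefficient recursion reads 4 s h'' + 2 d h' + h = 0, and the chain rule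
  turns this into Bessel's equation for Phi. The iterates of \<open>diffs\<close> provide the series
  of all derivatives at once.\<close>

lemma bessel_normalized_ode:
  assumes "d \<ge> 2"
  obtains f1 f2 where
    "\<And>x. (bessel_normalized d has_real_derivative f1 x) (at x)"
    "\<And>x. (f1 has_real_derivative f2 x) (at x)"
    "\<And>x. x * f2 x + (real d - 1) * f1 x + x * bessel_normalized d x = 0"
proof -
  define c where "c = bessel_coeff d"
  define h where "h n s = (\<Sum>m. (diffs ^^ n) c m * s ^ m)" for n and s :: real
  have summ: "summable (\<lambda>m. (diffs ^^ n) c m * s ^ m)" for n s
  proof (induction n arbitrary: s)
    case 0
    show ?case using summable_bessel_coeff[OF assms] by (simp add: c_def)
  next
    case (Suc n)
    show ?case using termdiff_converges_all[OF Suc] by simp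
  qed
  have h: "(h n has_real_derivative h (Suc n) s) (at s)" for n s
    unfolding h_def using termdiffs_strong_converges_everywhere[OF summ, of n s] by simp
  have rec: "4 * (real m + 1) * (real m + real d / 2) * c (Suc m) = - c m" for m
  proof -
    have nz: "real m + 1 \<noteq> 0" "real m + real d / 2 \<noteq> 0" "pochhammer (real d / 2) m \<noteq> 0"
      using assms pochhammer_pos[of "real d / 2" m] by auto
    have "c (Suc m) = - ((- 1) ^ m) / ((4 * (real m + 1) * (real m + real d / 2)) * (4 ^ m * fact m * pochhammer (real d / 2) m))"
      by (simp add: c_def bessel_coeff_def pochhammer_Suc mult_ac add_ac) (simp add: algebra_simps)
    moreover have "4 * A * B * (- X / ((4 * A * B) * P)) = - (X / P)" if "A \<noteq> 0" "B \<noteq> 0" for A B X P :: real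
      using that by simp
    ultimately show ?thesis using nz by (simp only: c_def bessel_coeff_def)
  qed
  have ode: "4 * s * h 2 s + 2 * real d * h 1 s + h 0 s = 0" for s
  proof -
    have "(\<lambda>m. diffs (diffs c) m * s ^ m) sums h 2 s"
      using summ[of 2 s] unfolding h_def by (simp add: numeral_2_eq_2 summable_sums)
    from sums_mult[OF this, of s] have "(\<lambda>m. real (Suc m) * real (Suc (Suc m)) * c (Suc (Suc m)) * s ^ Suc m) sums (s * h 2 s)"
      by (simp add: diffs_def mult_ac)
    hence 2: "(\<lambda>m. real m * real (Suc m) * c (Suc m) * s ^ m) sums (s * h 2 s)"
      using sums_Suc_iff[of "\<lambda>m. real m * real (Suc m) * c (Suc m) * s ^ m" "s * h 2 s"] by simp
    have 1: "(\<lambda>m. diffs c m * s ^ m) sums h 1 s"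
      using summ[of 1 s] unfolding h_def by (simp add: summable_sums)
    have 0: "(\<lambda>m. c m * s ^ m) sums h 0 s"
      using summ[of 0 s] unfolding h_def by (simp add: summable_sums)
    have "(\<lambda>m. 4 * (real m * real (Suc m) * c (Suc m) * s ^ m) + 2 * real d * (diffs c m * s ^ m) + c m * s ^ m)
       sums (4 * (s * h 2 s) + 2 * real d * h 1 s + h 0 s)"
      by (intro sums_add sums_mult 0 1 2)
    moreover have "4 * (real m * real (Suc m) * c (Suc m) * s ^ m) + 2 * real d * (diffs c m * s ^ m) + c m * s ^ m = 0" for m
    proof -
      have "4 * (real m * real (Suc m) * c (Suc m) * s ^ m) + 2 * real d * (diffs c m * s ^ m) + c m * s ^ m
         = (4 * (real m + 1) * (real m + real d / 2) * c (Suc m) + c m) * s ^ m"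
        by (simp add: diffs_def algebra_simps)
      thus ?thesis by (simp only: rec) simp
    qed
    ultimately show ?thesis by (simp add: sums_iff)
  qed
  have sq: "((\<lambda>x. h n (x\<^sup>2)) has_real_derivative h (Suc n) (x\<^sup>2) * (2 * x)) (at x)" for n x
    by (rule DERIV_chain2[OF h]) (auto intro!: derivative_eq_intros)
  have f0: "bessel_normalized d = (\<lambda>x. h 0 (x\<^sup>2))"
    by (simp add: fun_eq_iff bessel_normalized_def h_def c_def)
  show ?thesis
  proof (rule that)
    fix x :: real
    show "(bessel_normalized d has_real_derivative h 1 (x\<^sup>2) * (2 * x)) (at x)"
      unfolding f0 using sq[of 0 x] by simp
    show "((\<lambda>x. h 1 (x\<^sup>2) * (2 * x)) has_real_derivative h 2 (x\<^sup>2) * (2 * x) * (2 * x) + h 1 (x\<^sup>2) * 2) (at x)"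
      by (rule DERIV_cong[OF DERIV_mult[OF sq[of 1] DERIV_cmult_Id]]) (simp add: numeral_2_eq_2)
    have "x * (h 2 (x\<^sup>2) * (2 * x) * (2 * x) + h 1 (x\<^sup>2) * 2) + (real d - 1) * (h 1 (x\<^sup>2) * (2 * x)) + x * h 0 (x\<^sup>2)
      = x * (4 * x\<^sup>2 * h 2 (x\<^sup>2) + 2 * real d * h 1 (x\<^sup>2) + h 0 (x\<^sup>2))"
      by (simp add: algebra_simps power2_eq_square)
    also have "\<dots> = 0" by (simp only: ode mult_zero_right)
    finally show "x * (h 2 (x\<^sup>2) * (2 * x) * (2 * x) + h 1 (x\<^sup>2) * 2) + (real d - 1) * (h 1 (x\<^sup>2) * (2 * x)) + x * bessel_normalized d x = 0"
      by (simp only: f0)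
  qed
qed

lemma bessel_normalized_eq_bessel_J:
  assumes "d \<ge> 2" "x > 0"
  shows "2 powr (real d / 2 - 1) * Gamma (real d / 2) * bessel_J (real d / 2 - 1) x * x powr (- (real d / 2 - 1))
     = bessel_normalized d x"
proof -
  define \<nu> where "\<nu> = real d / 2 - 1"
  have G: "Gamma (real d / 2) > 0" using assms by (intro Gamma_real_pos) auto
  have coeff: "(- 1) ^ m / fact m * rGamma (real m + \<nu> + 1) * (x / 2) ^ (2 * m)
      = bessel_coeff d m * (x\<^sup>2) ^ m / Gamma (real d / 2)" for m
  proof -
    have "real d / 2 \<notin> \<int>\<^sub>\<le>\<^sub>0" using assms by (auto elim!: nonpos_Ints_cases)
    hence "pochhammer (real d / 2) m = Gamma (real d / 2 + real m) / Gamma (real d / 2)"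
      by (rule pochhammer_Gamma)
    hence "rGamma (real m + \<nu> + 1) = 1 / (pochhammer (real d / 2) m * Gamma (real d / 2))"
      using G by (simp add: rGamma_inverse_Gamma inverse_eq_divide \<nu>_def add_ac)
    moreover have "(x / 2) ^ (2 * m) = (x\<^sup>2) ^ m / 4 ^ m"
      by (simp add: power_mult power_divide)
    ultimately show ?thesis by (simp add: bessel_coeff_def)
  qed
  have "bessel_J \<nu> x = (x / 2) powr \<nu> * (bessel_normalized d x / Gamma (real d / 2))"
    unfolding bessel_J_def coeff bessel_normalized_def
    using summable_bessel_coeff[OF \<open>d \<ge> 2\<close>] by (simp add: suminf_divide)
  moreover have "(x / 2) powr \<nu> = x powr \<nu> / 2 powr \<nu>" using assms by (simp add: powr_divide)
  ultimately show ?thesis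
    using G assms by (simp add: powr_minus field_simps flip: \<nu>_def)
qed

lemma bessel_integrand_eq:
  assumes "d \<ge> 2" "q \<ge> 1" "x \<ge> 0"
  shows "(2 powr (real d / 2 - 1) * Gamma (real d / 2)) ^ q * bessel_integrand q d x
     = bessel_normalized d x ^ q * x ^ (d - 1)"
\<comment> \<open>At 0 both sides vanish: a real power of 0 is 0 whatever its exponent, and d - 1 >
  0.\<close>
proof (cases "x = 0")
  case True
  thus ?thesis using assms by (simp add: bessel_integrand_def)
next
  case False
  hence x: "x > 0" using assms by simp
  define \<nu> where "\<nu> = real d / 2 - 1"
  have "x powr (- real q * \<nu> + real d - 1) = x powr (- \<nu> * real q) * x powr real (d - 1)"
    using assms by (simp add: powr_add[symmetric] of_nat_diff algebra_simps)
  also have "\<dots> = (x powr (- \<nu>)) ^ q * x ^ (d - 1)"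
    using x powr_realpow[of "x powr - \<nu>" q] by (simp add: powr_powr powr_realpow)
  finally show ?thesis
    unfolding bessel_integrand_def \<nu>_def[symmetric] bessel_normalized_eq_bessel_J[OF assms(1) x, symmetric]
    by (simp add: power_mult_distrib)
qed

lemma tendsto_nat_mult_sin_divide: "(\<lambda>l. real l * sin (c / real l)) \<longlonglongrightarrow> c"
proof -
  have "((\<lambda>x. sin (c * x)) has_real_derivative c) (at 0)"
    by (auto intro!: derivative_eq_intros)
  hence "((\<lambda>h. sin (c * h) / h) \<longlongrightarrow> c) (at 0)" by (simp add: DERIV_def)
  moreover have "filterlim (\<lambda>l. inverse (real l)) (at 0) sequentially"
    by (intro filterlim_atI lim_inverse_n eventually_mono[OF eventually_gt_at_top[of 0]]) auto
  ultimately have "(\<lambda>l. sin (c * inverse (real l)) / inverse (real l)) \<longlonglongrightarrow> c"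
    by (rule filterlim_compose)
  thus ?thesis by (simp add: field_simps)
qed

text \<open>With (cos(x/l) - 1)/2 = -sin^2(x/(2l)) the k-th term is a product of k factors, each
  convergent because l sin(x/(2l)) tends to x/2. For j <= l and l >= 1, (l-j)(l+d-1+j) <= d l^2,
  which yields the dominating series (d (x/2)^2)^k / k!.\<close>

theorem mehler_heine_gegenbauer:
  assumes "d \<ge> 2"
  shows "(\<lambda>l. poly (gegenbauer_poly d l) (cos (x / real l))) \<longlonglongrightarrow> bessel_normalized d x"
proof -
  define s where "s l = sin (x / 2 / real l)" for l
  define a where "a k l = gegenbauer_coeff d l k * (- (s l)\<^sup>2) ^ k" for k l
  have G: "poly (gegenbauer_poly d l) (cos (x / real l)) = (\<Sum>k. a k l)" for l
  proof -
    have "(cos (x / real l) - 1) / 2 = - (s l)\<^sup>2"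
      using cos_double_sin[of "x / 2 / real l"] by (simp add: s_def field_simps)
    hence "poly (gegenbauer_poly d l) (cos (x / real l)) = (\<Sum>k\<le>l. a k l)"
      using assms by (simp add: poly_gegenbauer_poly_expand_at_1 a_def)
    also have "\<dots> = (\<Sum>k. a k l)"
      by (rule suminf_finite[symmetric]) (auto simp: a_def gegenbauer_coeff_eq_0)
    finally show ?thesis .
  qed
  have a_prod: "a k l = (\<Prod>j<k. (real l - real j) * (real l + real d - 1 + real j) * (- (s l)\<^sup>2) / ((real j + 1) * (real j + real d / 2)))" for k l
    unfolding a_def gegenbauer_coeff_def prod_constant[symmetric, of "- (s l)\<^sup>2" "{..<k}", unfolded card_lessThan] prod.distrib[symmetric]
    by simp
  have b_prod: "bessel_coeff d k * (x\<^sup>2) ^ k = (\<Prod>j<k. - (x / 2 * (x / 2)) / ((real j + 1) * (real j + real d / 2)))" for k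
  proof -
    have "(\<Prod>j<k. - (x / 2 * (x / 2)) / ((real j + 1) * (real j + real d / 2)))
       = (- (x / 2 * (x / 2))) ^ k / (fact k * pochhammer (real d / 2) k)"
      unfolding prod_dividef prod.distrib prod_constant card_lessThan
      by (simp add: pochhammer_prod fact_prod_Suc add_ac atLeast0LessThan)
    also have "(- (x / 2 * (x / 2))) ^ k = (- 1 / 4 * x\<^sup>2) ^ k" by (simp add: power2_eq_square)
    also have "\<dots> = (- 1) ^ k * (x\<^sup>2) ^ k / 4 ^ k" by (simp only: power_mult_distrib power_divide times_divide_eq_left)
    finally show ?thesis by (simp add: bessel_coeff_def)
  qed
  have ls: "(\<lambda>l. real l * s l) \<longlonglongrightarrow> x / 2" unfolding s_def by (rule tendsto_nat_mult_sin_divide)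
  have s0: "s \<longlonglongrightarrow> 0"
  proof -
    have "(\<lambda>l. sin (x / 2 / real l)) \<longlonglongrightarrow> sin 0"
      by (intro tendsto_sin real_tendsto_divide_at_top[OF tendsto_const filterlim_real_sequentially])
    thus ?thesis by (simp add: s_def[abs_def])
  qed
  have "eventually (\<lambda>l. summable (\<lambda>k. norm (a k l))) sequentially \<and> summable (\<lambda>k. norm (bessel_coeff d k * (x\<^sup>2) ^ k)) \<and>
      ((\<lambda>l. \<Sum>k. a k l) \<longlonglongrightarrow> (\<Sum>k. bessel_coeff d k * (x\<^sup>2) ^ k))"
  proof (rule tannerys_theorem)
    show "(\<lambda>l. a k l) \<longlonglongrightarrow> bessel_coeff d k * (x\<^sup>2) ^ k" for k
      unfolding a_prod b_prod
    proof (intro tendsto_prod tendsto_divide tendsto_const)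
      fix j
      \<comment> \<open>Each linear factor receives one factor s: then l s tends to x/2, while j s
        and (d-1+j) s tend to 0.\<close>
      have "(\<lambda>l. - ((real l * s l - real j * s l) * (real l * s l + (real d - 1 + real j) * s l))) \<longlonglongrightarrow>
          - ((x / 2 - real j * 0) * (x / 2 + (real d - 1 + real j) * 0))"
        by (intro tendsto_intros ls s0)
      thus "(\<lambda>l. (real l - real j) * (real l + real d - 1 + real j) * - (s l)\<^sup>2) \<longlonglongrightarrow> - (x / 2 * (x / 2))"
        by (simp add: algebra_simps power2_eq_square)
      show "(real j + 1) * (real j + real d / 2) \<noteq> 0" using assms by auto
    qed
    show "summable (\<lambda>k. inverse (fact k) * (real d * (x / 2)\<^sup>2) ^ k)" by (rule summable_exp)
    have "norm (a k l) \<le> inverse (fact k) * (real d * (x / 2)\<^sup>2) ^ k" if l: "l \<ge> 1" for k l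
    proof (cases "k \<le> l")
      case False
      thus ?thesis by (simp add: a_def gegenbauer_coeff_eq_0)
    next
      case True
      have "norm (a k l) \<le> (\<Prod>j<k. real d * (x / 2)\<^sup>2 / (real j + 1))"
        unfolding a_prod prod_norm[symmetric]
      proof (intro prod_mono conjI norm_ge_zero)
        fix j assume "j \<in> {..<k}"
        hence j: "real j \<le> real l" using True by simp
        have sb: "(s l)\<^sup>2 \<le> (x / 2 / real l)\<^sup>2"
          unfolding s_def using abs_sin_x_le_abs_x by (rule abs_le_square_iff[THEN iffD1])
        have d1: "real d \<ge> 1" using assms by simp
        have "(real l - real j) * (real l + real d - 1 + real j) = real l * (real l + (real d - 1)) - real j * (real d - 1) - real j * real j"
          by (simp add: algebra_simps)
        also have "\<dots> \<le> real l * (real l + (real d - 1))" 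
          using mult_nonneg_nonneg[of "real j" "real d - 1"] mult_nonneg_nonneg[of "real j" "real j"] d1 by linarith
        also have "\<dots> \<le> real l * (real l + (real d - 1) * real l)"
          using l d1 by (intro mult_left_mono add_left_mono) (auto simp: mult_le_cancel_left1)
        also have "\<dots> = real d * (real l)\<^sup>2" by (simp add: algebra_simps power2_eq_square)
        finally have "(real l - real j) * (real l + real d - 1 + real j) * (s l)\<^sup>2 \<le> (real d * (real l)\<^sup>2) * (x / 2 / real l)\<^sup>2"
          using sb by (rule mult_mono) auto
        also have "\<dots> = real d * (x / 2)\<^sup>2" using l by (simp add: power_divide)
        finally have A: "(real l - real j) * (real l + real d - 1 + real j) * (s l)\<^sup>2 \<le> real d * (x / 2)\<^sup>2" .
        have nn: "0 \<le> (real l - real j) * (real l + real d - 1 + real j) * (s l)\<^sup>2"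
          using j d1 by (intro mult_nonneg_nonneg) auto
        have dd: "(real j + 1) * 1 \<le> (real j + 1) * (real j + real d / 2)"
          using assms by (intro mult_left_mono) auto
        have "norm ((real l - real j) * (real l + real d - 1 + real j) * - (s l)\<^sup>2 / ((real j + 1) * (real j + real d / 2)))
          = (real l - real j) * (real l + real d - 1 + real j) * (s l)\<^sup>2 / ((real j + 1) * (real j + real d / 2))"
        proof -
          have "(real l - real j) * (real l + real d - 1 + real j) * - (s l)\<^sup>2 / ((real j + 1) * (real j + real d / 2))
            = - ((real l - real j) * (real l + real d - 1 + real j) * (s l)\<^sup>2 / ((real j + 1) * (real j + real d / 2)))"
            by simp
          moreover have "0 \<le> (real l - real j) * (real l + real d - 1 + real j) * (s l)\<^sup>2 / ((real j + 1) * (real j + real d / 2))"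
            using nn dd by (intro divide_nonneg_nonneg) auto
          ultimately show ?thesis by (simp only: abs_minus_cancel real_norm_def abs_of_nonneg)
        qed
        also have "\<dots> \<le> real d * (x / 2)\<^sup>2 / ((real j + 1) * 1)"
          using A nn dd by (intro frac_le) auto
        finally show "norm ((real l - real j) * (real l + real d - 1 + real j) * - (s l)\<^sup>2 / ((real j + 1) * (real j + real d / 2)))
          \<le> real d * (x / 2)\<^sup>2 / (real j + 1)" by simp
      qed
      also have "\<dots> = inverse (fact k) * (real d * (x / 2)\<^sup>2) ^ k"
        by (simp add: prod_dividef fact_prod_Suc atLeast0LessThan add_ac inverse_eq_divide)
      finally show ?thesis .
    qed
    thus "eventually (\<lambda>(k, l). norm (a k l) \<le> inverse (fact k) * (real d * (x / 2)\<^sup>2) ^ k) (at_top \<times>\<^sub>F sequentially)"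
      unfolding eventually_prod_filter
      by (intro exI[of _ "\<lambda>_. True"] exI[of _ "\<lambda>l. l \<ge> 1"]) (auto simp: eventually_ge_at_top)
  qed simp
  thus ?thesis unfolding G bessel_normalized_def by blast
qed

section \<open>Bounds on Phi inherited through the Mehler-Heine limit\<close>

lemma eventually_divide_nat_le:
  assumes "c > 0"
  shows "eventually (\<lambda>l. x / real l \<le> c) sequentially"
proof -
  have "(\<lambda>l. x / real l) \<longlonglongrightarrow> 0"
    by (rule real_tendsto_divide_at_top[OF tendsto_const filterlim_real_sequentially])
  from order_tendstoD(2)[OF this assms] show ?thesis by (rule eventually_mono) simp
qed

lemma abs_bessel_normalized_le_1:
  assumes "d \<ge> 2" "x \<ge> 0"
  shows "\<bar>bessel_normalized d x\<bar> \<le> 1"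
proof (rule tendsto_upperbound[OF tendsto_rabs[OF mehler_heine_gegenbauer[OF assms(1)]]])
  have "pi / 2 > 0" by simp
  from eventually_divide_nat_le[OF this, of x]
  show "eventually (\<lambda>l. \<bar>poly (gegenbauer_poly d l) (cos (x / real l))\<bar> \<le> 1) sequentially"
    by (rule eventually_mono) (intro abs_gegenbauer_le_1, use assms in auto)
qed simp

text \<open>The limit of \<open>gegenbauer_decay\<close> at theta = x/l, because l sin(x/l) tends to
  x.\<close>

lemma bessel_normalized_decay:
  assumes "d \<ge> 3" "x > 0"
  defines "\<kappa> \<equiv> (real d - 1) / 2"
  shows "\<bar>bessel_normalized d x\<bar> \<le> 3 * (2 * \<kappa> / x) powr \<kappa>"
proof (rule tendsto_le)
  show "(\<lambda>l. \<bar>poly (gegenbauer_poly d l) (cos (x / real l))\<bar>) \<longlonglongrightarrow> \<bar>bessel_normalized d x\<bar>"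
    using assms by (intro tendsto_rabs mehler_heine_gegenbauer) auto
  show "(\<lambda>l. 3 * (2 * \<kappa> / (real l * sin (x / real l))) powr \<kappa>) \<longlonglongrightarrow> 3 * (2 * \<kappa> / x) powr \<kappa>"
    using assms
    by (intro tendsto_mult[OF tendsto_const] tendsto_powr[OF tendsto_divide] tendsto_const tendsto_nat_mult_sin_divide)
       (auto simp: \<kappa>_def)
  have "pi / 2 > 0" by simp
  from eventually_divide_nat_le[OF this, of x] eventually_ge_at_top[of 1]
  show "eventually (\<lambda>l. \<bar>poly (gegenbauer_poly d l) (cos (x / real l))\<bar> \<le> 3 * (2 * \<kappa> / (real l * sin (x / real l))) powr \<kappa>) sequentially"
    by eventually_elim (unfold \<kappa>_def, intro gegenbauer_decay, use assms in auto)
qed simp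

section \<open>The absolutely convergent case\<close>

definition gegenbauer_integral :: "nat \<Rightarrow> nat \<Rightarrow> nat \<Rightarrow> real" where
  "gegenbauer_integral q d l =
     integral {0..pi / 2} (\<lambda>\<theta>. poly (gegenbauer_poly d l) (cos \<theta>) ^ q * sin \<theta> ^ (d - 1))"

text \<open>For x >= 0 this is the integrand of the constant with its prefactor absorbed
  (\<open>bessel_integrand_eq\<close>). It is continuous on the whole line, so integrability on
  compact intervals is immediate.\<close>

definition bessel_kernel :: "nat \<Rightarrow> nat \<Rightarrow> real \<Rightarrow> real" where
  "bessel_kernel q d x = bessel_normalized d x ^ q * x ^ (d - 1)"

lemma continuous_on_bessel_normalized:
  assumes "d \<ge> 2"
  shows "continuous_on A (bessel_normalized d)"
  using bessel_normalized_ode[OF assms] by (metis DERIV_continuous_on has_field_derivative_at_within)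

lemma continuous_on_bessel_kernel:
  assumes "d \<ge> 2"
  shows "continuous_on A (bessel_kernel q d)"
  unfolding bessel_kernel_def by (intro continuous_intros continuous_on_bessel_normalized assms)

text \<open>The inequality sin y >= y cos y at y = x/2, multiplied by 2 cos y, gives sin x >= x
  cos^2(x/2), and cos^2(x/2) >= 1/2 while cos x >= 0. Any linear lower bound would do; the factor
  only affects \<open>B\<close>.\<close>

lemma sin_ge_half:
  fixes x :: real
  assumes "0 \<le> x" "x \<le> pi / 2"
  shows "x / 2 \<le> sin x"
proof -
  have "sin 0 - 0 * cos 0 \<le> sin (x / 2) - x / 2 * cos (x / 2)"
  proof (rule DERIV_nonneg_imp_nondecreasing[where f = "\<lambda>y. sin y - y * cos y"])
    fix y assume y: "0 \<le> y" "y \<le> x / 2"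
    have "((\<lambda>y. sin y - y * cos y) has_real_derivative y * sin y) (at y)"
      by (auto intro!: derivative_eq_intros)
    moreover have "y * sin y \<ge> 0" using y assms by (intro mult_nonneg_nonneg sin_ge_zero) auto
    ultimately show "\<exists>D. ((\<lambda>y. sin y - y * cos y) has_real_derivative D) (at y) \<and> 0 \<le> D" by blast
  qed (use assms in auto)
  moreover have c: "cos (x / 2) \<ge> 0" using assms by (intro cos_ge_zero) auto
  ultimately have "x * (cos (x / 2))\<^sup>2 \<le> 2 * sin (x / 2) * cos (x / 2)"
    using mult_right_mono[of "x / 2 * cos (x / 2)" "sin (x / 2)" "cos (x / 2)"] by (simp add: power2_eq_square)
  also have "\<dots> = sin x" using sin_double[of "x / 2"] by simp
  finally have "x * (cos (x / 2))\<^sup>2 \<le> sin x" .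
  moreover have "x * (1 / 2) \<le> x * (cos (x / 2))\<^sup>2"
    using cos_double_cos[of "x / 2"] cos_ge_zero[of x] assms by (intro mult_left_mono) auto
  ultimately show ?thesis by simp
qed

lemma tendsto_integral_at_top:
  fixes f :: "real \<Rightarrow> real"
  assumes "f absolutely_integrable_on {a..}"
  shows "((\<lambda>R. integral {a..R} f) \<longlongrightarrow> integral {a..} f) at_top"
proof -
  have "((\<lambda>R. set_lebesgue_integral lebesgue {a..R} f) \<longlongrightarrow> set_lebesgue_integral lebesgue {a..} f) at_top"
    using assms by (intro tendsto_set_lebesgue_integral_at_top) auto
  moreover have "f absolutely_integrable_on {a..R}" for R
    using assms by (rule set_integrable_subset) auto
  ultimately show ?thesis using assms by (simp add: set_lebesgue_integral_eq_integral)
qed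

text \<open>\<open>B\<close> arises from the bound in \<open>gegenbauer_decay\<close> by doubling 2
  \<kappa>, which pays for l sin(x/l) >= x/2.\<close>

locale absolutely_convergent_case =
  fixes q d :: nat and \<kappa> B :: real
  assumes qd: "q \<ge> 3" "d \<ge> 3" "(d, q) \<noteq> (3, 3)"
  defines "\<kappa> \<equiv> (real d - 1) / 2"
  defines "B \<equiv> 3 * (4 * \<kappa>) powr \<kappa>"
begin

text \<open>The trivial bound is used on [0,1]; beyond 1 the decay x^(-\<kappa> q) meets x^(d-1) =
  x^(2 \<kappa>). At x = 1 both summands count, which is harmless for an upper bound.\<close>

definition dominator :: "real \<Rightarrow> real" where
  "dominator x = (if x \<in> {0..1} then 1 else 0) + (if x \<in> {1..} then B ^ q * x powr (- (\<kappa> * (real q - 2))) else 0)"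

lemma kappa: "\<kappa> \<ge> 1" "real d - 1 = 2 * \<kappa>" "real (d - 1) = 2 * \<kappa>"
  using qd by (auto simp: \<kappa>_def of_nat_diff)

text \<open>The pair d = q = 3 would give exactly 1, the borderline of integrability; its exclusion
  enters here.\<close>

lemma exponent: "\<kappa> * (real q - 2) > 1"
proof (cases "q = 3")
  case True
  with qd have "d \<ge> 4" by auto
  thus ?thesis using True by (simp add: \<kappa>_def)
next
  case False
  hence "real q - 2 \<ge> 2" using qd by auto
  hence "1 * 2 \<le> \<kappa> * (real q - 2)" using kappa by (intro mult_mono) auto
  thus ?thesis by simp
qed

lemma dominator_nonneg: "dominator x \<ge> 0"
  by (simp add: dominator_def B_def)

lemma dominator_integrable: "dominator integrable_on {0..}"
proof -
  have I: "{0..1} \<inter> {0..} = {0..1 :: real}" "{1..} \<inter> {0..} = {1 :: real..}" by auto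
  have "(\<lambda>x::real. if x \<in> {0..1} then 1 else 0 :: real) integrable_on {0..}"
    unfolding integrable_restrict_Int I by (rule integrable_const_ivl)
  moreover have "(\<lambda>x. B ^ q * x powr (- (\<kappa> * (real q - 2)))) integrable_on {1..}"
    using has_integral_integrable[OF has_integral_mult_right[OF has_integral_powr_to_inf[of "- (\<kappa> * (real q - 2))" 1]]]
      exponent by simp
  hence "(\<lambda>x. if x \<in> {1..} then B ^ q * x powr (- (\<kappa> * (real q - 2))) else 0) integrable_on {0..}"
    unfolding integrable_restrict_Int I .
  ultimately show ?thesis unfolding dominator_def by (rule integrable_add)
qed

text \<open>Kept abstract in g and s: s = l sin(x/l) serves the rescaled Gegenbauer integrand, s = x
  the Bessel kernel.\<close>

lemma dominator_bound:
  assumes "x \<ge> 0" "\<bar>g\<bar> \<le> 1" "x > 0 \<Longrightarrow> \<bar>g\<bar> \<le> B * x powr (- \<kappa>)" "\<bar>s\<bar> \<le> x"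
  shows "\<bar>g ^ q * s ^ (d - 1)\<bar> \<le> dominator x"
proof (cases "x \<le> 1")
  case True
  have "\<bar>g ^ q * s ^ (d - 1)\<bar> \<le> 1 * 1"
    unfolding abs_mult power_abs using assms True by (intro mult_mono power_le_one) auto
  moreover have "B ^ q \<ge> 0" by (simp add: B_def)
  ultimately show ?thesis using True assms by (auto simp: dominator_def)
next
  case False
  hence "x > 0" by simp
  hence xd: "x ^ (d - 1) = x powr (2 * \<kappa>)" unfolding kappa(3)[symmetric] by (rule powr_realpow[symmetric])
  have "\<bar>g ^ q * s ^ (d - 1)\<bar> \<le> (B * x powr (- \<kappa>)) ^ q * x ^ (d - 1)"
    unfolding abs_mult power_abs using assms False by (intro mult_mono power_mono) auto
  also have "\<dots> = B ^ q * (x powr (- \<kappa> * real q) * x powr (2 * \<kappa>))"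
    using False powr_realpow[of "x powr - \<kappa>" q] xd
    by (simp add: power_mult_distrib powr_powr)
  also have "x powr (- \<kappa> * real q) * x powr (2 * \<kappa>) = x powr (- (\<kappa> * (real q - 2)))"
    by (simp add: powr_add[symmetric] algebra_simps)
  finally show ?thesis using False by (simp add: dominator_def)
qed

lemma gegenbauer_scaled_bound:
  assumes "l \<ge> 1" "0 < x" "x \<le> real l * pi / 2"
  shows "\<bar>poly (gegenbauer_poly d l) (cos (x / real l))\<bar> \<le> B * x powr (- \<kappa>)"
proof -
  define \<theta> where "\<theta> = x / real l"
  have t: "0 < \<theta>" "\<theta> \<le> pi / 2" using assms by (auto simp: \<theta>_def field_simps)
  have "\<bar>poly (gegenbauer_poly d l) (cos \<theta>)\<bar> \<le> 3 * (2 * \<kappa> / (real l * sin \<theta>)) powr \<kappa>"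
    unfolding \<kappa>_def using qd assms t by (intro gegenbauer_decay) auto
  also have "\<dots> \<le> 3 * (4 * \<kappa> / x) powr \<kappa>"
  proof -
    have "real l * (\<theta> / 2) \<le> real l * sin \<theta>" using sin_ge_half[of \<theta>] t by (intro mult_left_mono) auto
    also have "real l * (\<theta> / 2) = x / 2" using assms by (simp add: \<theta>_def)
    finally have le: "x / 2 \<le> real l * sin \<theta>" .
    have "x / 2 > 0" using assms by simp
    moreover have P: "real l * sin \<theta> > 0" using le \<open>x / 2 > 0\<close> by linarith
    ultimately have "2 * \<kappa> / (real l * sin \<theta>) \<le> 2 * \<kappa> / (x / 2)"
      using le kappa by (intro divide_left_mono) (auto simp del: zero_less_mult_iff)
    also have "\<dots> = 4 * \<kappa> / x" using assms by (simp add: field_simps)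
    finally have "2 * \<kappa> / (real l * sin \<theta>) \<le> 4 * \<kappa> / x" .
    moreover have "0 \<le> 2 * \<kappa> / (real l * sin \<theta>)" using kappa P by (intro divide_nonneg_pos) (auto simp del: zero_less_mult_iff)
    ultimately show ?thesis using kappa by (intro mult_left_mono powr_mono2) auto
  qed
  also have "\<dots> = B * x powr (- \<kappa>)"
    using assms kappa by (simp add: B_def powr_divide powr_minus field_simps)
  finally show ?thesis by (simp add: \<theta>_def)
qed

lemma bessel_kernel_bound: 
  assumes "x \<ge> 0"
  shows "\<bar>bessel_kernel q d x\<bar> \<le> dominator x"
  unfolding bessel_kernel_def
proof (rule dominator_bound)
  show "\<bar>bessel_normalized d x\<bar> \<le> 1" using assms qd by (intro abs_bessel_normalized_le_1) auto
  assume x: "x > 0"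
  have "\<bar>bessel_normalized d x\<bar> \<le> 3 * (2 * \<kappa> / x) powr \<kappa>"
    unfolding \<kappa>_def using qd x by (intro bessel_normalized_decay) auto
  \<comment> \<open>Weakened from 2 \<kappa> to 4 \<kappa> so that one dominating function serves
    both sides.\<close>
  also have "\<dots> \<le> 3 * (4 * \<kappa> / x) powr \<kappa>"
    using x kappa by (intro mult_left_mono powr_mono2 divide_right_mono mult_right_mono) auto
  also have "\<dots> = B * x powr (- \<kappa>)"
    using x kappa by (simp add: B_def powr_divide powr_minus field_simps)
  finally show "\<bar>bessel_normalized d x\<bar> \<le> B * x powr (- \<kappa>)" .
qed (use assms in auto)

lemma bessel_kernel_absolutely_integrable: "bessel_kernel q d absolutely_integrable_on {0..}"
proof (rule measurable_bounded_by_integrable_imp_absolutely_integrable)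
  show "bessel_kernel q d \<in> borel_measurable (lebesgue_on {0..})"
    using qd by (intro continuous_imp_measurable_on_sets_lebesgue continuous_on_bessel_kernel) auto
  show "norm (bessel_kernel q d x) \<le> dominator x" if "x \<in> {0..}" for x
    using bessel_kernel_bound[of x] that by simp
qed (use dominator_integrable in auto)

text \<open>Substitution theta = x/l, extended by 0. Of the factors in l^d, d - 1 sit in the power
  of the sine and the last one comes from d theta.\<close>

definition scaled_integrand :: "nat \<Rightarrow> real \<Rightarrow> real" where
  "scaled_integrand l x = (if x \<in> {0..real l * pi / 2}
     then poly (gegenbauer_poly d l) (cos (x / real l)) ^ q * (real l * sin (x / real l)) ^ (d - 1) else 0)"

lemma scaled_integrand_integrable: "scaled_integrand l integrable_on {0..}"
proof -
  have "{0..real l * pi / 2} \<inter> {0..} = {0..real l * pi / 2}" by auto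
  moreover have "(\<lambda>x. poly (gegenbauer_poly d l) (cos (x / real l)) ^ q * (real l * sin (x / real l)) ^ (d - 1))
      integrable_on {0..real l * pi / 2}"
    by (intro integrable_continuous_real) (cases "l = 0"; auto intro!: continuous_intros)
  ultimately show ?thesis
    unfolding scaled_integrand_def integrable_restrict_Int by simp
qed

lemma integral_scaled_integrand:
  assumes "l \<ge> 1"
  shows "integral {0..} (scaled_integrand l) = real l ^ d * gegenbauer_integral q d l"
proof -
  have "{0..real l * pi / 2} \<inter> {0..} = {0..real l * pi / 2}" by auto
  moreover have "(\<lambda>x. x / (1 / real l)) ` {0..pi / 2} = {0..real l * pi / 2}"
    using assms by (subst image_divide_atLeastAtMost) (auto simp: mult_ac)
  ultimately have "integral {0..} (scaled_integrand l)
      = integral ((\<lambda>x. x / (1 / real l)) ` {0..pi / 2}) (\<lambda>x. (\<lambda>\<theta>. poly (gegenbauer_poly d l) (cos \<theta>) ^ q * (real l * sin \<theta>) ^ (d - 1)) (1 / real l * x))"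
    unfolding scaled_integrand_def integral_restrict_Int by simp
  also have "\<dots> = real l * integral {0..pi / 2} (\<lambda>\<theta>. poly (gegenbauer_poly d l) (cos \<theta>) ^ q * (real l * sin \<theta>) ^ (d - 1))"
    using assms by (subst integral_stretch_real) auto
  also have "(\<lambda>\<theta>. poly (gegenbauer_poly d l) (cos \<theta>) ^ q * (real l * sin \<theta>) ^ (d - 1))
    = (\<lambda>\<theta>. real l ^ (d - 1) * (poly (gegenbauer_poly d l) (cos \<theta>) ^ q * sin \<theta> ^ (d - 1)))"
    by (simp add: power_mult_distrib mult_ac)
  also have "real l * integral {0..pi / 2} \<dots> = real l ^ Suc (d - 1) * gegenbauer_integral q d l"
    by (simp add: gegenbauer_integral_def)
  finally show ?thesis using qd by simp
qed

lemma gegenbauer_integral_limit: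
  "(\<lambda>l. real l ^ d * gegenbauer_integral q d l) \<longlonglongrightarrow> integral {0..} (bessel_kernel q d)"
proof (rule Lim_transform_eventually)
  show "(\<lambda>l. integral {0..} (scaled_integrand l)) \<longlonglongrightarrow> integral {0..} (bessel_kernel q d)"
  proof (rule dominated_convergence(2)[OF scaled_integrand_integrable dominator_integrable])
    fix l :: nat and x :: real assume x: "x \<in> {0..}"
    show "norm (scaled_integrand l x) \<le> dominator x"
    proof (cases "x \<in> {0..real l * pi / 2}")
      case False
      thus ?thesis unfolding scaled_integrand_def by (simp only: if_False) (simp add: dominator_nonneg)
    next
      case True
      have "\<bar>poly (gegenbauer_poly d l) (cos (x / real l)) ^ q * (real l * sin (x / real l)) ^ (d - 1)\<bar> \<le> dominator x"
      proof (rule dominator_bound)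
        show "0 \<le> x" using x by simp
        \<comment> \<open>For l = 0 the quotient x / l is 0, so the angle still lies in the quarter
          period.\<close>
        show "\<bar>poly (gegenbauer_poly d l) (cos (x / real l))\<bar> \<le> 1"
          using True qd by (cases "l = 0"; intro abs_gegenbauer_le_1) (auto simp: field_simps)
        show "\<bar>poly (gegenbauer_poly d l) (cos (x / real l))\<bar> \<le> B * x powr - \<kappa>" if "x > 0"
          using True that by (intro gegenbauer_scaled_bound) (auto simp: Suc_le_eq intro!: Nat.gr0I)
        show "\<bar>real l * sin (x / real l)\<bar> \<le> x"
          using x mult_left_mono[OF abs_sin_x_le_abs_x[of "x / real l"], of "real l"]
          by (cases "l = 0") (auto simp: abs_mult)
      qed
      thus ?thesis using True by (simp add: scaled_integrand_def)
    qed
  next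
    fix x :: real assume x: "x \<in> {0..}"
    show "(\<lambda>l. scaled_integrand l x) \<longlonglongrightarrow> bessel_kernel q d x"
    proof (rule Lim_transform_eventually)
      show "(\<lambda>l. poly (gegenbauer_poly d l) (cos (x / real l)) ^ q * (real l * sin (x / real l)) ^ (d - 1)) \<longlonglongrightarrow> bessel_kernel q d x"
        unfolding bessel_kernel_def
        using qd by (intro tendsto_mult tendsto_power mehler_heine_gegenbauer tendsto_nat_mult_sin_divide) auto
      have "pi / 2 > 0" by simp
      from eventually_divide_nat_le[OF this, of x] eventually_gt_at_top[of 0]
      show "eventually (\<lambda>l. poly (gegenbauer_poly d l) (cos (x / real l)) ^ q * (real l * sin (x / real l)) ^ (d - 1) = scaled_integrand l x) sequentially"
        by eventually_elim (use x in \<open>auto simp: scaled_integrand_def field_simps\<close>)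
    qed
  qed
  show "eventually (\<lambda>l. integral {0..} (scaled_integrand l) = real l ^ d * gegenbauer_integral q d l) sequentially"
    using eventually_ge_at_top[of 1] by eventually_elim (rule integral_scaled_integrand)
qed

end

section \<open>The case d = q = 3\<close>

text \<open>For d = 3 these are the Chebyshev polynomials of the second kind, divided by l + 1. The
  difference z of the two sides solves z'' = -n^2 z with z(0) = z'(0) = 0, and the conserved energy
  n^2 z^2 + z'^2 forces z = 0.\<close>

lemma sin_mult_gegenbauer_3:
  "sin \<theta> * poly (gegenbauer_poly 3 l) (cos \<theta>) = sin (real (Suc l) * \<theta>) / real (Suc l)"
proof -
  define n where "n = real (Suc l)"
  have n: "n > 0" by (simp add: n_def)
  define g where "g \<theta> = poly (gegenbauer_poly 3 l) (cos \<theta>)" for \<theta>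
  obtain g1 g2 where g: "\<And>\<theta>. (g has_real_derivative g1 \<theta>) (at \<theta>)"
      and g1: "\<And>\<theta>. (g1 has_real_derivative g2 \<theta>) (at \<theta>)"
      and ode: "\<And>\<theta>. sin \<theta> * g2 \<theta> + (real 3 - 1) * cos \<theta> * g1 \<theta> + real l * (real l + real 3 - 1) * sin \<theta> * g \<theta> = 0"
    using gegenbauer_ode[of 3 l] unfolding g_def by (metis one_le_numeral)
  define z where "z \<theta> = sin \<theta> * g \<theta> - sin (n * \<theta>) / n" for \<theta>
  define z1 where "z1 \<theta> = cos \<theta> * g \<theta> + sin \<theta> * g1 \<theta> - cos (n * \<theta>)" for \<theta>
  have z: "(z has_real_derivative z1 \<theta>) (at \<theta>)" for \<theta>
    unfolding z_def z1_def using n by (auto intro!: derivative_eq_intros g)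
  have z1: "(z1 has_real_derivative - n\<^sup>2 * z \<theta>) (at \<theta>)" for \<theta>
  proof -
    have "(z1 has_real_derivative - sin \<theta> * g \<theta> + 2 * cos \<theta> * g1 \<theta> + sin \<theta> * g2 \<theta> + n * sin (n * \<theta>)) (at \<theta>)"
      unfolding z1_def by (auto intro!: derivative_eq_intros g g1)
    also have "- sin \<theta> * g \<theta> + 2 * cos \<theta> * g1 \<theta> + sin \<theta> * g2 \<theta> + n * sin (n * \<theta>) = - n\<^sup>2 * z \<theta>"
    proof -
      have N: "real l * (real l + real 3 - 1) = n\<^sup>2 - 1" by (simp add: n_def power2_eq_square algebra_simps)
      have "n\<^sup>2 * (sin (n * \<theta>) / n) = n * sin (n * \<theta>)" using n by (simp add: power2_eq_square)
      thus ?thesis using ode[of \<theta>] unfolding N z_def by (simp add: algebra_simps)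
    qed
    finally show ?thesis .
  qed
  define E where "E \<theta> = n\<^sup>2 * (z \<theta>)\<^sup>2 + (z1 \<theta>)\<^sup>2" for \<theta>
  have "(E has_real_derivative 0) (at \<theta>)" for \<theta>
    unfolding E_def by (auto intro!: derivative_eq_intros z z1)
  hence "E \<theta> = E 0" by (intro DERIV_isconst_all) auto
  also have "g 0 = 1" using poly_gegenbauer_poly_1[of 3 l] by (simp add: g_def)
  hence "E 0 = 0" by (simp add: E_def z_def z1_def)
  finally have "n\<^sup>2 * (z \<theta>)\<^sup>2 = 0"
    unfolding E_def by (metis add_nonneg_eq_0_iff mult_nonneg_nonneg zero_le_power2)
  hence "z \<theta> = 0" using n by simp
  thus ?thesis by (simp add: z_def g_def n_def)
qed

text \<open>Uniqueness of the Mehler-Heine limit: for large l the polynomial equals sin((l+1)x/l) /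
  ((l+1) sin(x/l)), which tends to sin x / x.\<close>

lemma bessel_normalized_3:
  assumes "x > 0"
  shows "bessel_normalized 3 x = sin x / x"
proof (rule LIMSEQ_unique)
  show "(\<lambda>l. poly (gegenbauer_poly 3 l) (cos (x / real l))) \<longlonglongrightarrow> bessel_normalized 3 x"
    by (intro mehler_heine_gegenbauer) simp
  have x0: "(\<lambda>l. x / real l) \<longlonglongrightarrow> 0"
    by (rule real_tendsto_divide_at_top[OF tendsto_const filterlim_real_sequentially])
  have "(\<lambda>l. sin (x + x / real l) / (real l * sin (x / real l) + sin (x / real l))) \<longlonglongrightarrow> sin (x + 0) / (x + sin 0)"
    using assms by (intro tendsto_divide tendsto_add tendsto_sin tendsto_const x0 tendsto_nat_mult_sin_divide) auto
  hence "(\<lambda>l. sin (x + x / real l) / (real l * sin (x / real l) + sin (x / real l))) \<longlonglongrightarrow> sin x / x" by simp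
  moreover have "eventually (\<lambda>l. sin (x + x / real l) / (real l * sin (x / real l) + sin (x / real l))
      = poly (gegenbauer_poly 3 l) (cos (x / real l))) sequentially"
    using eventually_divide_nat_le[of 1 x, OF zero_less_one] eventually_gt_at_top[of 0]
  proof eventually_elim
    case (elim l)
    have "x / real l < pi" using elim(1) pi_gt3 by linarith
    hence "sin (x / real l) > 0" using elim assms by (intro sin_gt_zero) auto
    moreover have "real (Suc l) * (x / real l) = x + x / real l" using elim by (simp add: field_simps)
    moreover have "real (Suc l) * (sin (x / real l) * poly (gegenbauer_poly 3 l) (cos (x / real l))) = sin (real (Suc l) * (x / real l))"
      unfolding sin_mult_gegenbauer_3 by simp
    ultimately have "(real l * sin (x / real l) + sin (x / real l)) * poly (gegenbauer_poly 3 l) (cos (x / real l))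
        = sin (x + x / real l)" "real l * sin (x / real l) + sin (x / real l) \<noteq> 0"
      by (simp_all add: algebra_simps add_nonneg_eq_0_iff)
    thus ?case by (metis nonzero_mult_div_cancel_left)
  qed
  ultimately show "(\<lambda>l. poly (gegenbauer_poly 3 l) (cos (x / real l))) \<longlonglongrightarrow> sin x / x"
    by (rule Lim_transform_eventually)
qed

lemma sin_cubed: "sin x ^ 3 = (3 * sin x - sin (3 * x)) / (4 :: real)"
proof -
  have c: "(cos x)\<^sup>2 = 1 - (sin x)\<^sup>2" by (rule cos_squared_eq)
  have "sin (3 * x) = sin (2 * x + x)" by (simp add: algebra_simps)
  also have "\<dots> = 2 * sin x * (cos x)\<^sup>2 + (1 - 2 * (sin x)\<^sup>2) * sin x"
    unfolding sin_add sin_double cos_double_sin by (simp add: power2_eq_square)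
  also have "\<dots> = 3 * sin x - 4 * sin x ^ 3"
    unfolding c by (simp add: algebra_simps power2_eq_square power3_eq_cube)
  finally show ?thesis by simp
qed

section \<open>Integrals of sin(n theta)/sin(theta) over the quarter period\<close>

lemma gegenbauer_3_at_1 [simp]: "poly (gegenbauer_poly 3 l) 1 = 1"
  by (rule poly_gegenbauer_poly_1) simp

text \<open>By \<open>sin_mult_gegenbauer_3\<close> the integrand is \<open>sin ((l + 1) \<theta>) / sin \<theta>\<close>, extended continuously
  to \<open>\<theta> = 0\<close>.\<close>

definition dirichlet_integral :: "nat \<Rightarrow> real" where
  "dirichlet_integral l = integral {0..pi / 2} (\<lambda>\<theta>. real (Suc l) * poly (gegenbauer_poly 3 l) (cos \<theta>))"

lemma has_integral_dirichlet:
  "((\<lambda>\<theta>. real (Suc l) * poly (gegenbauer_poly 3 l) (cos \<theta>)) has_integral dirichlet_integral l) {0..pi / 2}"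
  unfolding dirichlet_integral_def
  by (rule integrable_integral, rule integrable_continuous_real) (auto intro!: continuous_intros)

lemma sin_pos_on_quarter: "0 \<le> \<theta> \<Longrightarrow> \<theta> \<le> pi / 2 \<Longrightarrow> \<theta> \<noteq> 0 \<Longrightarrow> sin \<theta> > 0"
  using pi_gt_zero sin_gt_zero[of \<theta>] by simp

lemma dirichlet_integral_0: "dirichlet_integral 0 = pi / 2"
proof -
  have "poly (gegenbauer_poly 3 0) t = 1" for t
    using poly_gegenbauer_poly_expand_at_1[of 3 0 t] by (simp add: gegenbauer_coeff_def)
  thus ?thesis by (simp add: dirichlet_integral_def)
qed

lemma has_integral_cos_mult:
  assumes "n > 0"
  shows "((\<lambda>\<theta>. 2 * cos (real n * \<theta>)) has_integral 2 * sin (real n * (pi / 2)) / real n) {0..pi / 2}"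
proof -
  have "((\<lambda>\<theta>. 2 * cos (real n * \<theta>)) has_integral (2 * sin (real n * (pi / 2)) / real n - 2 * sin (real n * 0) / real n)) {0..pi / 2}"
  proof (rule fundamental_theorem_of_calculus)
    fix x :: real
    have "((\<lambda>\<theta>. 2 * sin (real n * \<theta>) / real n) has_real_derivative 2 * cos (real n * x)) (at x within {0..pi / 2})"
      using assms by (auto intro!: derivative_eq_intros)
    thus "((\<lambda>\<theta>. 2 * sin (real n * \<theta>) / real n) has_vector_derivative 2 * cos (real n * x)) (at x within {0..pi / 2})"
      by (simp add: has_real_derivative_iff_has_vector_derivative)
  qed simp
  thus ?thesis by simp
qed

lemma dirichlet_integral_1: "dirichlet_integral 1 = 2"
proof -
  have "((\<lambda>\<theta>. 2 * cos (real 1 * \<theta>)) has_integral dirichlet_integral 1) {0..pi / 2}"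
  proof (rule has_integral_eq[OF _ has_integral_dirichlet[of 1]])
    fix \<theta> assume t: "\<theta> \<in> {0..pi / 2}"
    show "real (Suc 1) * poly (gegenbauer_poly 3 1) (cos \<theta>) = 2 * cos (real 1 * \<theta>)"
    proof (cases "\<theta> = 0")
      case False
      with t have s: "sin \<theta> > 0" by (intro sin_pos_on_quarter) auto
      have "sin \<theta> * (2 * poly (gegenbauer_poly 3 1) (cos \<theta>)) = sin \<theta> * (2 * cos \<theta>)"
        using sin_mult_gegenbauer_3[of \<theta> 1] sin_double[of \<theta>] by simp
      thus ?thesis using s by simp
    qed simp
  qed
  from has_integral_unique[OF this has_integral_cos_mult[of 1]] show ?thesis by simp
qed

text \<open>The integrands differ by 2 cos((l+2) theta), since sin(m + theta) - sin(m - theta) = 2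
  cos m sin theta.\<close>

lemma dirichlet_integral_rec:
  "dirichlet_integral (l + 2) = dirichlet_integral l + 2 * sin (real (l + 2) * (pi / 2)) / real (l + 2)"
proof -
  have "((\<lambda>\<theta>. 2 * cos (real (l + 2) * \<theta>)) has_integral dirichlet_integral (l + 2) - dirichlet_integral l) {0..pi / 2}"
  proof (rule has_integral_eq[OF _ has_integral_diff[OF has_integral_dirichlet has_integral_dirichlet]])
    fix \<theta> assume t: "\<theta> \<in> {0..pi / 2}"
    let ?G = "\<lambda>l. poly (gegenbauer_poly 3 l) (cos \<theta>)"
    show "real (Suc (l + 2)) * ?G (l + 2) - real (Suc l) * ?G l = 2 * cos (real (l + 2) * \<theta>)"
    proof (cases "\<theta> = 0")
      case False
      with t have s: "sin \<theta> > 0" by (intro sin_pos_on_quarter) auto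
      define m where "m = real (l + 2) * \<theta>"
      have e: "real (Suc (l + 2)) * \<theta> = m + \<theta>" "real (Suc l) * \<theta> = m - \<theta>"
        by (simp_all add: m_def algebra_simps)
      have k: "real (Suc k) * (sin \<theta> * ?G k) = sin (real (Suc k) * \<theta>)" for k
        unfolding sin_mult_gegenbauer_3 by simp
      have "sin \<theta> * (real (Suc (l + 2)) * ?G (l + 2) - real (Suc l) * ?G l)
         = real (Suc (l + 2)) * (sin \<theta> * ?G (l + 2)) - real (Suc l) * (sin \<theta> * ?G l)"
        by (simp only: right_diff_distrib mult.left_commute)
      also have "\<dots> = sin (m + \<theta>) - sin (m - \<theta>)" unfolding k e ..
      also have "\<dots> = sin \<theta> * (2 * cos m)" by (simp add: sin_add sin_diff)
      finally show ?thesis using s by (simp add: m_def)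
    qed simp
  qed
  from has_integral_unique[OF this has_integral_cos_mult[of "l + 2"]] show ?thesis by simp
qed

lemma dirichlet_integral_even: "dirichlet_integral (2 * m) = pi / 2"
proof (induction m)
  case (Suc m)
  have "sin (real (2 * m + 2) * (pi / 2)) = sin (real (Suc m) * pi)" by (simp add: algebra_simps)
  also have "\<dots> = 0" by (rule sin_npi)
  finally show ?case using dirichlet_integral_rec[of "2 * m"] Suc by simp
qed (simp add: dirichlet_integral_0)

text \<open>The boundary terms of the recurrence alternate in sign and build the Leibniz series,
  written here in the shape of \<open>pi_series\<close>.\<close>

lemma dirichlet_integral_odd: "dirichlet_integral (2 * m + 1) = 2 * (\<Sum>k\<le>m. (- 1) ^ k * 1 / real (k * 2 + 1))"
proof (induction m)
  case (Suc m)
  have "sin (real (2 * m + 1 + 2) * (pi / 2)) = sin (real (Suc m) * pi + pi / 2)" by (simp add: algebra_simps)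
  also have "\<dots> = (- 1) ^ Suc m" unfolding sin_add sin_npi cos_npi sin_pi_half cos_pi_half by simp
  finally show ?case using dirichlet_integral_rec[of "2 * m + 1"] Suc by (simp add: algebra_simps)
qed (simp add: dirichlet_integral_1[unfolded One_nat_def])

lemma dirichlet_integral_limit: "dirichlet_integral \<longlonglongrightarrow> pi / 2"
proof -
  have "summable (\<lambda>k. (- 1) ^ k * 1 / real (k * 2 + 1) :: real)"
    using summable_arctan_series[of 1] by simp
  hence "(\<lambda>m. \<Sum>k\<le>m. (- 1) ^ k * 1 / real (k * 2 + 1)) \<longlonglongrightarrow> pi / 4"
    unfolding pi_series by (rule summable_LIMSEQ')
  from tendsto_mult[OF tendsto_const[of 2] this]
  have "(\<lambda>m. dirichlet_integral (2 * m + 1)) \<longlonglongrightarrow> pi / 2" unfolding dirichlet_integral_odd by simp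
  hence "(\<lambda>m. dirichlet_integral (2 * m + 1) - pi / 2) \<longlonglongrightarrow> 0" by (simp add: LIM_zero_iff)
  moreover have "filterlim (\<lambda>l. l div 2) sequentially (sequentially :: nat filter)"
    unfolding filterlim_at_top
  proof
    fix Z :: nat
    show "eventually (\<lambda>l. Z \<le> l div 2) sequentially"
      using eventually_ge_at_top[of "2 * Z"] by eventually_elim simp
  qed
  ultimately have lim: "(\<lambda>l. dirichlet_integral (2 * (l div 2) + 1) - pi / 2) \<longlonglongrightarrow> 0"
    by (rule filterlim_compose)
  \<comment> \<open>For even l the left side is 0, and for odd l both sides coincide; thus the odd
    subsequence controls the whole sequence.\<close>
  have le: "norm (dirichlet_integral l - pi / 2) \<le> norm (dirichlet_integral (2 * (l div 2) + 1) - pi / 2)" for l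
  proof (cases "even l")
    case True
    thus ?thesis using dirichlet_integral_even[of "l div 2"] by simp
  next
    case False
    hence "2 * (l div 2) + 1 = l" by simp
    thus ?thesis by (simp only: order_refl)
  qed
  have "(\<lambda>l. dirichlet_integral l - pi / 2) \<longlonglongrightarrow> 0"
    by (rule Lim_null_comparison[OF always_eventually[OF allI[OF le]] tendsto_norm_zero[OF lim]])
  thus ?thesis by (simp add: LIM_zero_iff)
qed

text \<open>\<open>sin_cubed\<close> at (l+1) theta, divided by sin theta; the tripled frequency
  3(l+1) = (3l+2) + 1 belongs to the index 3l+2.\<close>

lemma gegenbauer_integral_3_3:
  "real (Suc l) ^ 3 * gegenbauer_integral 3 3 l = (3 * dirichlet_integral l - dirichlet_integral (3 * l + 2)) / 4"
proof -
  have "((\<lambda>\<theta>. real (Suc l) ^ 3 * (poly (gegenbauer_poly 3 l) (cos \<theta>) ^ 3 * sin \<theta> ^ (3 - 1))) has_integral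
     (3 * dirichlet_integral l - dirichlet_integral (3 * l + 2)) / 4) {0..pi / 2}"
  proof (rule has_integral_eq)
    show "((\<lambda>\<theta>. (3 * (real (Suc l) * poly (gegenbauer_poly 3 l) (cos \<theta>)) - real (Suc (3 * l + 2)) * poly (gegenbauer_poly 3 (3 * l + 2)) (cos \<theta>)) / 4) has_integral
     (3 * dirichlet_integral l - dirichlet_integral (3 * l + 2)) / 4) {0..pi / 2}"
      by (intro has_integral_divide has_integral_diff has_integral_mult_right has_integral_dirichlet)
    fix \<theta> assume t: "\<theta> \<in> {0..pi / 2}"
    let ?G = "\<lambda>l. poly (gegenbauer_poly 3 l) (cos \<theta>)"
    show "(3 * (real (Suc l) * ?G l) - real (Suc (3 * l + 2)) * ?G (3 * l + 2)) / 4
       = real (Suc l) ^ 3 * (?G l ^ 3 * sin \<theta> ^ (3 - 1))"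
    proof (cases "\<theta> = 0")
      case False
      with t have s: "sin \<theta> > 0" by (intro sin_pos_on_quarter) auto
      have k: "real (Suc k) * (sin \<theta> * ?G k) = sin (real (Suc k) * \<theta>)" for k
        unfolding sin_mult_gegenbauer_3 by simp
      have e: "real (Suc (3 * l + 2)) * \<theta> = 3 * (real (Suc l) * \<theta>)" by (simp add: algebra_simps)
      have "sin \<theta> * ((3 * (real (Suc l) * ?G l) - real (Suc (3 * l + 2)) * ?G (3 * l + 2)) / 4)
        = (3 * (real (Suc l) * (sin \<theta> * ?G l)) - real (Suc (3 * l + 2)) * (sin \<theta> * ?G (3 * l + 2))) / 4"
        by (simp only: right_diff_distrib mult.left_commute times_divide_eq_right)
      also have "\<dots> = sin (real (Suc l) * \<theta>) ^ 3" unfolding k e sin_cubed ..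
      also have "\<dots> = (real (Suc l) * (sin \<theta> * ?G l)) ^ 3" unfolding k ..
      also have "\<dots> = sin \<theta> * (real (Suc l) ^ 3 * (?G l ^ 3 * sin \<theta> ^ (3 - 1)))"
        by (simp add: power_mult_distrib power3_eq_cube power2_eq_square mult_ac)
      finally show ?thesis using s by (simp only: mult_cancel_left) simp
    qed (simp add: algebra_simps)
  qed
  thus ?thesis
    unfolding gegenbauer_integral_def by (simp add: integral_unique flip: integral_mult_right)
qed

lemma gegenbauer_integral_3_3_limit: "(\<lambda>l. real l ^ 3 * gegenbauer_integral 3 3 l) \<longlonglongrightarrow> pi / 4"
proof -
  have "filterlim (\<lambda>l. 3 * l + 2) sequentially (sequentially :: nat filter)"
    by (rule filterlim_subseq) (auto simp: strict_mono_def)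
  from filterlim_compose[OF dirichlet_integral_limit this]
  have "(\<lambda>l. (real l / real (Suc l)) ^ 3 * ((3 * dirichlet_integral l - dirichlet_integral (3 * l + 2)) / 4))
     \<longlonglongrightarrow> 1 ^ 3 * ((3 * (pi / 2) - pi / 2) / 4)"
    by (intro tendsto_intros dirichlet_integral_limit LIMSEQ_n_over_Suc_n) auto
  moreover have "(real l / real (Suc l)) ^ 3 * (real (Suc l) ^ 3 * gegenbauer_integral 3 3 l) = real l ^ 3 * gegenbauer_integral 3 3 l" for l
    unfolding power_divide by (simp del: of_nat_Suc)
  ultimately show ?thesis unfolding gegenbauer_integral_3_3[symmetric] by (simp del: of_nat_Suc)
qed

section \<open>The Bessel integral for d = q = 3\<close>

lemma bessel_kernel_3_3: "x > 0 \<Longrightarrow> bessel_kernel 3 3 x = sin x ^ 3 / x"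
  unfolding bessel_kernel_def by (simp add: bessel_normalized_3) (simp add: power3_eq_cube power2_eq_square)

text \<open>By \<open>sin_cubed\<close>, sin^3 x / x = (3 sinc x - 3 sinc(3x))/4, so
  \<open>Si\<close> yields an explicit antiderivative.\<close>

lemma integral_bessel_kernel_3_3:
  assumes "R \<ge> 0"
  shows "integral {0..R} (bessel_kernel 3 3) = (3 * Si R - Si (3 * R)) / 4"
proof -
  have "(bessel_kernel 3 3 has_integral ((3 * Si R - Si (3 * R)) / 4 - (3 * Si 0 - Si (3 * 0)) / 4)) {0..R}"
  proof (rule fundamental_theorem_of_calculus[OF assms])
    fix x assume x: "x \<in> {0..R}"
    have "((\<lambda>x. (3 * Si x - Si (3 * x)) / 4) has_real_derivative (3 * sinc x - sinc (3 * x) * 3) / 4) (at x)"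
      by (auto intro!: derivative_eq_intros DERIV_Si DERIV_chain2[OF DERIV_Si])
    also have "(3 * sinc x - sinc (3 * x) * 3) / 4 = bessel_kernel 3 3 x"
    proof (cases "x = 0")
      case True
      thus ?thesis by (simp add: bessel_kernel_def)
    next
      case False
      thus ?thesis using x by (simp add: bessel_kernel_3_3 sin_cubed diff_divide_distrib)
    qed
    finally show "((\<lambda>x. (3 * Si x - Si (3 * x)) / 4) has_vector_derivative bessel_kernel 3 3 x) (at x within {0..R})"
      by (simp add: has_real_derivative_iff_has_vector_derivative has_vector_derivative_at_within)
  qed
  moreover have "Si 0 = 0" using Si_neg[of 0] by simp
  ultimately show ?thesis by (simp add: integral_unique)
qed

lemma bessel_kernel_3_3_improper: "((\<lambda>R. integral {0..R} (bessel_kernel 3 3)) \<longlongrightarrow> pi / 4) at_top"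
proof (rule Lim_transform_eventually)
  have "filterlim (\<lambda>R::real. 3 * R) at_top at_top"
    by (rule filterlim_tendsto_pos_mult_at_top[OF tendsto_const]) (auto intro: filterlim_ident)
  from filterlim_compose[OF Si_at_top this]
  have "((\<lambda>R. (3 * Si R - Si (3 * R)) / 4) \<longlongrightarrow> (3 * (pi / 2) - pi / 2) / 4) at_top"
    by (intro tendsto_intros Si_at_top) auto
  thus "((\<lambda>R. (3 * Si R - Si (3 * R)) / 4) \<longlongrightarrow> pi / 4) at_top" by simp
  show "eventually (\<lambda>R. (3 * Si R - Si (3 * R)) / 4 = integral {0..R} (bessel_kernel 3 3)) at_top"
    using eventually_ge_at_top[of 0] by eventually_elim (simp add: integral_bessel_kernel_3_3)
qed

text \<open>Since \<open>sin\<^sup>4 + cos\<^sup>4 \<ge> 1/2\<close>, adding \<open>\<bar>f(x)\<bar>\<close> and \<open>\<bar>f(x + \<pi>/2)\<bar>\<close> gives a function that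
  dominates a shifted \<open>1/x\<close>.\<close>

lemma bessel_kernel_3_3_not_absolutely_integrable:
  "\<not> bessel_kernel 3 3 absolutely_integrable_on {0..}"
proof
  assume "bessel_kernel 3 3 absolutely_integrable_on {0..}"
  define f where "f x = \<bar>bessel_kernel 3 3 x\<bar>" for x
  have f: "f integrable_on {0..}"
    using \<open>bessel_kernel 3 3 absolutely_integrable_on {0..}\<close> unfolding f_def absolutely_integrable_on_def by simp
  define A where "A = integral {0..} f"
  have cont: "continuous_on S f" for S
    unfolding f_def by (intro continuous_intros continuous_on_bessel_kernel) auto
  have fA: "integral {a..b} f \<le> A" if "a \<ge> 0" for a b
    unfolding A_def using f that
    by (intro integral_subset_le integrable_continuous_real cont) (auto simp: f_def)
  have bound: "(ln (R + pi / 2) - ln (1 + pi / 2)) / 2 \<le> 2 * A" if R: "R \<ge> 1" for R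
  proof -
    have I1: "((\<lambda>x. 1 / (x + pi / 2) / 2) has_integral (ln (R + pi / 2) / 2 - ln (1 + pi / 2) / 2)) {1..R}"
    proof (rule fundamental_theorem_of_calculus[OF R])
      fix x :: real assume "x \<in> {1..R}"
      hence "x + pi / 2 > 0" using pi_gt_zero by (simp add: add_pos_pos)
      hence "((\<lambda>x. ln (x + pi / 2) / 2) has_real_derivative 1 / (x + pi / 2) / 2) (at x)"
        by (auto intro!: derivative_eq_intros simp: field_simps)
      thus "((\<lambda>x. ln (x + pi / 2) / 2) has_vector_derivative 1 / (x + pi / 2) / 2) (at x within {1..R})"
        by (simp add: has_real_derivative_iff_has_vector_derivative has_vector_derivative_at_within)
    qed
    have I2: "((\<lambda>x. 1 *\<^sub>R f (x + pi / 2)) has_integral integral {1 + pi / 2..R + pi / 2} f) {1..R}"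
      using R by (intro has_integral_substitution[where c = "1 + pi / 2" and d = "R + pi / 2"] cont)
        (auto intro!: derivative_eq_intros)
    have I3: "(f has_integral integral {1..R} f) {1..R}"
      by (intro integrable_integral integrable_continuous_real cont)
    have "ln (R + pi / 2) / 2 - ln (1 + pi / 2) / 2 \<le> integral {1..R} f + integral {1 + pi / 2..R + pi / 2} f"
    proof (rule has_integral_le[OF I1 has_integral_add[OF I3 I2]])
      fix x assume "x \<in> {1..R}"
      hence x: "x \<ge> 1" by simp
      have xp: "x + pi / 2 > 0" "x \<le> x + pi / 2" using x pi_gt_zero by linarith+
      \<comment> \<open>Raising the exponent from 3 to 4 is what makes sin^2 + cos^2 = 1
        applicable.\<close>
      have pow: "\<bar>s\<bar> ^ 3 \<ge> s ^ 4" if "\<bar>s\<bar> \<le> 1" for s :: real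
      proof -
        have "s ^ 4 = \<bar>s\<bar> ^ 4" by simp
        also have "\<dots> \<le> \<bar>s\<bar> ^ 3" using that by (intro power_decreasing) auto
        finally show ?thesis .
      qed
      have "(sin x)\<^sup>2 * (sin x)\<^sup>2 + (cos x)\<^sup>2 * (cos x)\<^sup>2 \<ge> 1 / 2"
      proof -
        have "(sin x)\<^sup>2 + (cos x)\<^sup>2 = 1" by simp
        hence c: "(cos x)\<^sup>2 = 1 - (sin x)\<^sup>2" by linarith
        have "a * a + (1 - a) * (1 - a) \<ge> 1 / 2" for a :: real
          using zero_le_power2[of "a - 1 / 2"] by (simp add: power2_eq_square algebra_simps)
        thus ?thesis unfolding c .
      qed
      hence "1 / (x + pi / 2) / 2 \<le> (sin x ^ 4 + cos x ^ 4) / (x + pi / 2)"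
        using xp by (simp add: divide_right_mono field_simps power4_eq_xxxx power2_eq_square)
      also have "\<dots> \<le> \<bar>sin x\<bar> ^ 3 / x + \<bar>cos x\<bar> ^ 3 / (x + pi / 2)"
        unfolding add_divide_distrib using xp x by (intro add_mono frac_le pow divide_right_mono) auto
      also have "\<dots> = f x + 1 *\<^sub>R f (x + pi / 2)"
      proof -
        have "f x = \<bar>sin x\<bar> ^ 3 / x" using x by (simp add: f_def bessel_kernel_3_3 abs_divide power_abs)
        moreover have "f (x + pi / 2) = \<bar>cos x\<bar> ^ 3 / (x + pi / 2)"
          unfolding f_def bessel_kernel_3_3[OF xp(1)] using xp(1) by (simp add: sin_add abs_divide power_abs)
        ultimately show ?thesis by simp
      qed
      finally show "1 / (x + pi / 2) / 2 \<le> f x + 1 *\<^sub>R f (x + pi / 2)" .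
    qed
    also have "\<dots> \<le> A + A" by (intro add_mono fA) auto
    finally show ?thesis by (simp add: diff_divide_distrib)
  qed
  \<comment> \<open>Chosen so that (ln R - ln(1 + pi/2))/2 exceeds 2A, against
    \<open>bound\<close>.\<close>
  define R where "R = max 1 (exp (4 * A + ln (1 + pi / 2) + 1))"
  have "4 * A + ln (1 + pi / 2) + 1 \<le> ln R"
    unfolding R_def by (subst ln_ge_iff) auto
  have R: "R \<ge> 1" by (simp add: R_def)
  note \<open>4 * A + ln (1 + pi / 2) + 1 \<le> ln R\<close>
  also have "ln R \<le> ln (R + pi / 2)" using R by (intro ln_mono) auto
  finally show False using bound[OF R] by simp
qed

section \<open>Arches of solutions of oscillatory equations\<close>

text \<open>The Wronskian u' v - u v' starts at 0 and has derivative (P - p) u v, so it is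
  nonnegative while u and v are positive. Hence u/v is nondecreasing, and the equal slopes at 0 give
  it the limit 1 there.\<close>

lemma sturm_comparison:
  fixes u v u1 v1 p P :: "real \<Rightarrow> real"
  assumes u: "\<And>t. 0 \<le> t \<Longrightarrow> t < T \<Longrightarrow> (u has_real_derivative u1 t) (at t)"
    and u1: "\<And>t. 0 \<le> t \<Longrightarrow> t < T \<Longrightarrow> (u1 has_real_derivative - p t * u t) (at t)"
    and v: "\<And>t. 0 \<le> t \<Longrightarrow> t < T \<Longrightarrow> (v has_real_derivative v1 t) (at t)"
    and v1: "\<And>t. 0 \<le> t \<Longrightarrow> t < T \<Longrightarrow> (v1 has_real_derivative - P t * v t) (at t)"
    and pP: "\<And>t. 0 \<le> t \<Longrightarrow> t < T \<Longrightarrow> p t \<le> P t"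
    and init: "u 0 = 0" "v 0 = 0" "u1 0 = a" "v1 0 = a" "a > 0"
    and vpos: "\<And>t. 0 < t \<Longrightarrow> t < T \<Longrightarrow> v t > 0"
    and t: "0 < t" "t < T"
  shows "v t \<le> u t"
proof -
  \<comment> \<open>Conditional on u > 0 below S; applied first up to a supposed first nonpositive
    point of u, to refute it, and then up to T.\<close>
  have main: "v t \<le> u t" if t: "0 < t" "t < S" and S: "S \<le> T" and upos: "\<And>t. 0 < t \<Longrightarrow> t < S \<Longrightarrow> u t > 0" for t S
  proof -
    define W where "W t = u1 t * v t - u t * v1 t" for t
    have Wpos: "W x \<ge> 0" if x: "0 \<le> x" "x < S" for x
    proof -
      have "W 0 \<le> W x"
      proof (rule DERIV_nonneg_imp_nondecreasing[OF x(1)])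
        fix z assume z: "0 \<le> z" "z \<le> x"
        hence zT: "z < T" using x S by simp
        have "(W has_real_derivative (P z - p z) * u z * v z) (at z)"
          unfolding W_def using z zT
          by (auto intro!: derivative_eq_intros u u1 v v1 simp: algebra_simps)
        moreover have "(P z - p z) * u z * v z \<ge> 0"
          using pP[of z] upos[of z] vpos[of z] z zT x init by (cases "z = 0") (auto intro!: mult_nonneg_nonneg)
        ultimately show "\<exists>D. (W has_real_derivative D) (at z) \<and> 0 \<le> D" by blast
      qed
      thus ?thesis by (simp add: W_def init)
    qed
    have r_mono: "u s / v s \<le> u t / v t" if s: "0 < s" "s \<le> t" for s
    proof (rule DERIV_nonneg_imp_nondecreasing[OF s(2)])
      fix z assume z: "s \<le> z" "z \<le> t"
      hence z': "0 < z" "z < T" "z < S" using s t S by auto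
      have "((\<lambda>z. u z / v z) has_real_derivative W z / (v z * v z)) (at z)"
        unfolding W_def using z' vpos[of z] by (auto intro!: derivative_eq_intros u v)
      moreover have "W z / (v z * v z) \<ge> 0" using Wpos[of z] z' by simp
      ultimately show "\<exists>D. ((\<lambda>z. u z / v z) has_real_derivative D) (at z) \<and> 0 \<le> D" by blast
    qed
    have "((\<lambda>h. (u h / h) / (v h / h)) \<longlongrightarrow> a / a) (at 0)"
      using u[of 0] v[of 0] init t S by (intro tendsto_divide) (auto simp: DERIV_def)
    hence "((\<lambda>h. (u h / h) / (v h / h)) \<longlongrightarrow> 1) (at_right 0)"
      using init by (simp add: filterlim_at_split)
    moreover have "eventually (\<lambda>h. (u h / h) / (v h / h) \<le> u t / v t) (at_right 0)"
      using eventually_at_right_real[OF t(1)]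
    proof eventually_elim
      case (elim h)
      thus ?case using r_mono[of h] by simp
    qed
    ultimately have "1 \<le> u t / v t"
      by (rule tendsto_upperbound) simp
    thus ?thesis using vpos[of t] t S by (simp add: field_simps)
  qed
  have cont: "continuous_on {0..s} u" if "s < T" for s
    using u that by (intro DERIV_continuous_on[of _ _ u1]) (auto intro: has_field_derivative_at_within)
  have contv: "continuous_on {0..s} v" if "s < T" for s
    using v that by (intro DERIV_continuous_on[of _ _ v1]) (auto intro: has_field_derivative_at_within)
  have upos: "u s > 0" if s: "0 < s" "s < T" for s
  proof (rule ccontr)
    assume neg: "\<not> u s > 0"
    obtain \<delta> where d: "\<delta> > 0" "\<And>h. 0 < h \<Longrightarrow> h < \<delta> \<Longrightarrow> u h > 0"
      using DERIV_pos_inc_right[OF u[of 0]] init s by auto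
    \<comment> \<open>The cut at \<open>min \<delta> s\<close> removes the zero of u at 0, so that
      the least element of \<open>Z\<close> is positive.\<close>
    define Z where "Z = {0..s} \<inter> u -` {..0} \<inter> {min \<delta> s..}"
    have "closed Z"
      unfolding Z_def by (intro closed_Int continuous_closed_preimage[OF cont[OF s(2)]] closed_atLeastAtMost closed_atMost closed_atLeast)
    moreover have "bounded Z" by (rule bounded_subset[OF bounded_closed_interval[of 0 s]]) (auto simp: Z_def)
    ultimately have "compact Z" by (simp add: compact_eq_bounded_closed)
    moreover have "s \<in> Z" using s neg by (simp add: Z_def not_less)
    hence "Z \<noteq> {}" by blast
    ultimately obtain t1 where t1: "t1 \<in> Z" "\<And>z. z \<in> Z \<Longrightarrow> t1 \<le> z"
      by (meson compact_attains_inf)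
    have t1b: "0 < t1" "t1 \<le> s" "u t1 \<le> 0" using t1(1) d s by (auto simp: Z_def)
    have up: "u z > 0" if "0 < z" "z < t1" for z
    proof (cases "z < \<delta>")
      case True thus ?thesis using d that by simp
    next
      case False
      thus ?thesis using t1(2)[of z] that t1b by (cases "u z > 0") (auto simp: Z_def)
    qed
    have le: "v z \<le> u z" if "0 < z" "z < t1" for z
      using main[OF that] up t1b s by simp
    have isu: "(u \<longlongrightarrow> u t1) (at_left t1)" and isv: "(v \<longlongrightarrow> v t1) (at_left t1)"
      using DERIV_isCont[OF u[of t1]] DERIV_isCont[OF v[of t1]] t1b s
      by (auto simp: isCont_def filterlim_at_split)
    have "v t1 \<le> u t1"
      using eventually_at_left_real[OF t1b(1)]
      by (intro tendsto_le[OF _ isu isv]) (auto elim!: eventually_mono intro: le)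
    thus False using vpos[of t1] t1b s by simp
  qed
  show ?thesis using main[OF t order_refl upos] .
qed

lemma linear_ode_zero:
  fixes y y1 \<phi> :: "real \<Rightarrow> real"
  assumes y: "\<And>x. a \<le> x \<Longrightarrow> x \<le> c \<Longrightarrow> (y has_real_derivative y1 x) (at x)"
    and y1: "\<And>x. a \<le> x \<Longrightarrow> x \<le> c \<Longrightarrow> (y1 has_real_derivative - \<phi> x * y x) (at x)"
    and M: "\<And>x. a \<le> x \<Longrightarrow> x \<le> c \<Longrightarrow> \<bar>1 - \<phi> x\<bar> \<le> M"
    and "a \<le> c" "y c = 0" "y1 c = 0"
  shows "y a = 0"
proof -
  \<comment> \<open>\<open>y\<^sup>2 + y1\<^sup>2\<close> decays at rate at most \<open>M\<close>, hence vanishes to the left of \<open>c\<close>\<close>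
  define E where "E x = exp (M * x) * ((y x)\<^sup>2 + (y1 x)\<^sup>2)" for x
  have "E a \<le> E c"
  proof (rule DERIV_nonneg_imp_nondecreasing[OF \<open>a \<le> c\<close>])
    fix x assume x: "a \<le> x" "x \<le> c"
    let ?D = "exp (M * x) * (M * ((y x)\<^sup>2 + (y1 x)\<^sup>2) + (1 - \<phi> x) * (2 * y x * y1 x))"
    have "(E has_real_derivative ?D) (at x)"
      unfolding E_def by (auto intro!: derivative_eq_intros y y1 x simp: algebra_simps power2_eq_square)
    moreover have "?D \<ge> 0"
    proof -
      have "\<bar>2 * y x * y1 x\<bar> \<le> (y x)\<^sup>2 + (y1 x)\<^sup>2"
        using sum_squares_bound[of "y x" "y1 x"] sum_squares_bound[of "y x" "- y1 x"] by (simp add: abs_le_iff)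
      hence "\<bar>1 - \<phi> x\<bar> * \<bar>2 * y x * y1 x\<bar> \<le> M * ((y x)\<^sup>2 + (y1 x)\<^sup>2)"
        using M[OF x] by (intro mult_mono) auto
      hence "M * ((y x)\<^sup>2 + (y1 x)\<^sup>2) + (1 - \<phi> x) * (2 * y x * y1 x) \<ge> 0"
        unfolding abs_mult[symmetric] by (simp add: abs_le_iff)
      thus ?thesis by simp
    qed
    ultimately show "\<exists>D. (E has_real_derivative D) (at x) \<and> 0 \<le> D" by blast
  qed
  hence "(y a)\<^sup>2 + (y1 a)\<^sup>2 \<le> 0" using assms by (simp add: E_def mult_le_0_iff)
  thus ?thesis using sum_power2_le_zero_iff by blast
qed

text \<open>The equation is required only for x > 0, since the Bessel potential is in general
  singular at 0; continuity of y at 0 lets the first arch begin there. The potential may be negative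
  near 0.\<close>

locale sturm_oscillator =
  fixes y y1 \<phi> :: "real \<Rightarrow> real"
  assumes y: "\<And>x. x > 0 \<Longrightarrow> (y has_real_derivative y1 x) (at x)"
    and y1: "\<And>x. x > 0 \<Longrightarrow> (y1 has_real_derivative - \<phi> x * y x) (at x)"
    and cont: "continuous_on {0..} y"
    and \<phi>_mono: "\<And>x z. 0 < x \<Longrightarrow> x \<le> z \<Longrightarrow> \<phi> x \<le> \<phi> z"
    and \<phi>_le_1: "\<And>x. 0 < x \<Longrightarrow> \<phi> x \<le> 1"
begin

definition arch :: "real \<Rightarrow> real \<Rightarrow> real \<Rightarrow> bool" where
  "arch s b c \<longleftrightarrow> 0 \<le> b \<and> b < c \<and> y b = 0 \<and> y c = 0 \<and> (\<forall>x. b < x \<and> x < c \<longrightarrow> s * y x > 0)"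

text \<open>Comparison with \<open>sin\<close> bounds the next arch length from below, comparison with the arch
  reflected in its right endpoint \<open>c\<close> bounds it from above; the latter also proves that the next
  zero exists.\<close>

lemma next_arch:
  assumes arch: "arch s b c" and s: "s = 1 \<or> s = -1"
  obtains \<tau> where "pi \<le> \<tau>" "\<tau> \<le> c - b" "arch (- s) c (c + \<tau>)"
    "\<And>t. 0 < t \<Longrightarrow> t < \<tau> \<Longrightarrow> \<bar>y (c + t)\<bar> \<le> \<bar>y (c - t)\<bar>"
proof -
  have bc: "0 \<le> b" "b < c" "y b = 0" "y c = 0" and pos: "\<And>x. b < x \<Longrightarrow> x < c \<Longrightarrow> s * y x > 0"
    using arch by (auto simp: arch_def)
  have c: "c > 0" using bc by simp
  define a where "a = - s * y1 c"
  \<comment> \<open>\<open>u\<close> is the arch reflected in c, \<open>v\<close> the continuation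
    beyond c; the signs make both start at 0 with the same slope \<open>a\<close>.\<close>
  define u where "u t = s * y (c - t)" for t
  define u1 where "u1 t = - s * y1 (c - t)" for t
  define v where "v t = - s * y (c + t)" for t
  define v1 where "v1 t = - s * y1 (c + t)" for t
  have chain: "((\<lambda>t. y (g t)) has_real_derivative y1 (g t) * g') (at t)"
      "((\<lambda>t. y1 (g t)) has_real_derivative - \<phi> (g t) * y (g t) * g') (at t)"
    if "(g has_real_derivative g') (at t)" "g t > 0" for g g' t
    by (rule DERIV_chain2[OF y[OF that(2)] that(1)], rule DERIV_chain2[OF y1[OF that(2)] that(1)])
  have Du: "(u has_real_derivative u1 t) (at t)" if "t < c" for t
    unfolding u_def u1_def using that
    by (auto intro!: derivative_eq_intros chain)
  have Du1: "(u1 has_real_derivative - \<phi> (c - t) * u t) (at t)" if "t < c" for t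
    unfolding u_def u1_def using that
    by (auto intro!: derivative_eq_intros chain)
  have Dv: "(v has_real_derivative v1 t) (at t)" if "t \<ge> 0" for t
    unfolding v_def v1_def using that c
    by (auto intro!: derivative_eq_intros chain)
  have Dv1: "(v1 has_real_derivative - \<phi> (c + t) * v t) (at t)" if "t \<ge> 0" for t
    unfolding v_def v1_def using that c
    by (auto intro!: derivative_eq_intros chain)
  \<comment> \<open>The zero at c is simple: otherwise uniqueness for the linear equation would make
    y vanish inside the arch.\<close>
  have a: "a > 0"
  proof (rule ccontr)
    assume "\<not> a > 0"
    moreover have "\<not> a < 0"
    proof
      assume "a < 0"
      have "(u has_real_derivative a) (at 0)" using Du[of 0] c by (simp add: u1_def a_def)
      from DERIV_neg_dec_right[OF this \<open>a < 0\<close>] obtain \<delta> where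
        d: "\<delta> > 0" "\<And>h. 0 < h \<Longrightarrow> h < \<delta> \<Longrightarrow> u h < 0" by (auto simp: u_def bc)
      define h where "h = min \<delta> (c - b) / 2"
      have "0 < h" "h < \<delta>" "h < c - b" using d bc by (auto simp: h_def)
      thus False using d(2)[of h] pos[of "c - h"] by (auto simp: u_def)
    qed
    ultimately have "y1 c = 0" using s by (auto simp: a_def)
    define m where "m = (b + c) / 2"
    have m: "0 < m" "b < m" "m < c" using bc by (auto simp: m_def)
    have "y m = 0"
    proof (rule linear_ode_zero[of m c y y1 \<phi> "1 - \<phi> m"])
      show "\<bar>1 - \<phi> x\<bar> \<le> 1 - \<phi> m" if "m \<le> x" "x \<le> c" for x
        using \<phi>_mono[of m x] \<phi>_le_1[of x] m that by auto
    qed (use m y y1 bc \<open>y1 c = 0\<close> in auto)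
    thus False using pos[OF m(2,3)] by simp
  qed
  have init: "u 0 = 0" "v 0 = 0" "u1 0 = a" "v1 0 = a"
    by (auto simp: u_def v_def u1_def v1_def a_def bc)
  have vu: "v t \<le> u t" if T: "T \<le> c" "\<And>t. 0 < t \<Longrightarrow> t < T \<Longrightarrow> v t > 0" and t: "0 < t" "t < T" for t T
  proof (rule sturm_comparison[of T u u1 "\<lambda>t. \<phi> (c - t)" v v1 "\<lambda>t. \<phi> (c + t)" a])
    show "\<phi> (c - t) \<le> \<phi> (c + t)" if "0 \<le> t" "t < T" for t
      using that T by (intro \<phi>_mono) auto
  qed (use T t Du Du1 Dv Dv1 init a in auto)
  have contv: "continuous_on {0..} v"
    unfolding v_def using c by (intro continuous_intros continuous_on_compose2[OF cont]) auto
  have contu: "continuous_on {0..c} u"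
    unfolding u_def by (intro continuous_intros continuous_on_compose2[OF cont]) auto
  have vsin: "v t > 0" if t: "0 < t" "t < pi" for t
  proof -
    have "a * sin t \<le> v t"
    proof (rule sturm_comparison[of pi v v1 "\<lambda>t. \<phi> (c + t)" "\<lambda>t. a * sin t" "\<lambda>t. a * cos t" "\<lambda>_. 1" a])
      show "\<phi> (c + t) \<le> 1" if "0 \<le> t" for t using that c by (intro \<phi>_le_1) auto
      show "a * sin t > 0" if "0 < t" "t < pi" for t using that a by (simp add: sin_gt_zero)
    qed (use t Dv Dv1 init a in \<open>auto intro!: derivative_eq_intros\<close>)
    moreover have "a * sin t > 0" using t a by (simp add: sin_gt_zero)
    ultimately show ?thesis by linarith
  qed
  \<comment> \<open>Otherwise v <= u up to t = c - b, where u vanishes. The comparison reaches this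
    endpoint only through continuity, since for b = 0 it corresponds to x = 0.\<close>
  have ex: "\<exists>t. 0 < t \<and> t \<le> c - b \<and> v t \<le> 0"
  proof (rule ccontr)
    assume "\<not> ?thesis"
    hence vpos: "v t > 0" if "0 < t" "t \<le> c - b" for t using that by force
    have "v (c - b) \<le> u (c - b)"
    proof (rule tendsto_le)
      have "continuous_on {0..c - b} u" "continuous_on {0..c - b} v"
        by (rule continuous_on_subset[OF contu] continuous_on_subset[OF contv], use bc in auto)+
      thus "(u \<longlongrightarrow> u (c - b)) (at_left (c - b))" "(v \<longlongrightarrow> v (c - b)) (at_left (c - b))"
        using bc by (auto intro!: continuous_on_Icc_at_leftD)
      have "0 < c - b" using bc by simp
      from eventually_at_left_real[OF this]
      show "eventually (\<lambda>t. v t \<le> u t) (at_left (c - b))"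
        by eventually_elim (use vu[of "c - b"] vpos bc in auto)
    qed simp
    thus False using vpos[of "c - b"] bc by (simp add: u_def)
  qed
  \<comment> \<open>Starting at pi excludes the zero of v at t = 0; \<open>vsin\<close> shows that
    nothing else is lost.\<close>
  define Z where "Z = {t \<in> {pi..c - b}. v t \<le> 0}"
  have "Z = {pi..c - b} \<inter> v -` {..0}" by (auto simp: Z_def)
  moreover have "closed ({pi..c - b} \<inter> v -` {..0})"
    by (intro continuous_closed_preimage continuous_on_subset[OF contv]) auto
  ultimately have "closed Z" by simp
  moreover have "bounded Z" by (rule bounded_subset[OF bounded_closed_interval[of pi "c - b"]]) (auto simp: Z_def)
  ultimately have "compact Z" by (simp add: compact_eq_bounded_closed)
  moreover have "Z \<noteq> {}" using ex vsin by (force simp: Z_def not_less[symmetric])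
  ultimately obtain \<tau> where \<tau>: "\<tau> \<in> Z" "\<And>t. t \<in> Z \<Longrightarrow> \<tau> \<le> t"
    by (meson compact_attains_inf)
  have tb: "pi \<le> \<tau>" "\<tau> \<le> c - b" "0 < \<tau>" using \<tau>(1) less_le_trans[OF pi_gt_zero, of \<tau>] by (auto simp: Z_def)
  have vpos: "v t > 0" if "0 < t" "t < \<tau>" for t
  proof (cases "t < pi")
    case True thus ?thesis using vsin that by simp
  next
    case False
    thus ?thesis using \<tau>(2)[of t] that tb by (force simp: Z_def)
  qed
  have v0: "v \<tau> = 0"
  proof (rule antisym)
    show "v \<tau> \<le> 0" using \<tau>(1) by (simp add: Z_def)
    have "isCont v \<tau>" using DERIV_isCont[OF Dv[of \<tau>]] tb by simp
    hence "(v \<longlongrightarrow> v \<tau>) (at_left \<tau>)" by (simp add: isCont_def filterlim_at_split)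
    moreover have "eventually (\<lambda>t. 0 \<le> v t) (at_left \<tau>)"
      using eventually_at_left_real[OF tb(3)] by eventually_elim (auto dest: vpos intro: less_imp_le)
    ultimately show "0 \<le> v \<tau>" by (rule tendsto_lowerbound) simp
  qed
  show ?thesis
  proof (rule that[OF tb(1,2)])
    have "0 < - s * y x" if "c < x" "x < c + \<tau>" for x
      using vpos[of "x - c"] that by (simp add: v_def)
    thus "arch (- s) c (c + \<tau>)"
      using v0 s tb c bc by (auto simp: arch_def v_def)
    fix t assume t: "0 < t" "t < \<tau>"
    have "v t \<le> u t" using vu[of \<tau> t] vpos t tb bc by auto
    moreover have "v t > 0" using vpos t by simp
    ultimately show "\<bar>y (c + t)\<bar> \<le> \<bar>y (c - t)\<bar>"
      using s by (auto simp: u_def v_def)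
  qed
qed

end

section \<open>Positivity of the constant\<close>

text \<open>\<kappa> >= 1 makes \<kappa>(\<kappa>-1) nonnegative, hence the potential monotone and
  at most 1.\<close>

lemma bessel_sturm_oscillator:
  assumes "d \<ge> 3"
  defines "\<kappa> \<equiv> (real d - 1) / 2"
  obtains y1 where "sturm_oscillator (\<lambda>x. x powr \<kappa> * bessel_normalized d x) y1 (\<lambda>x. 1 - \<kappa> * (\<kappa> - 1) / x\<^sup>2)"
proof -
  have k: "\<kappa> \<ge> 1" "real d - 1 = 2 * \<kappa>" using assms by (auto simp: \<kappa>_def)
  have "d \<ge> 2" using assms by simp
  from bessel_normalized_ode[OF this] obtain f1 f2 where
    f: "\<And>x. (bessel_normalized d has_real_derivative f1 x) (at x)"
    and f1: "\<And>x. (f1 has_real_derivative f2 x) (at x)"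
    and ode: "\<And>x. x * f2 x + 2 * \<kappa> * f1 x + x * bessel_normalized d x = 0"
    unfolding k(2) by metis
  define y1 where "y1 x = \<kappa> * x powr (\<kappa> - 1) * bessel_normalized d x + x powr \<kappa> * f1 x" for x
  have "sturm_oscillator (\<lambda>x. x powr \<kappa> * bessel_normalized d x) y1 (\<lambda>x. 1 - \<kappa> * (\<kappa> - 1) / x\<^sup>2)"
  proof
    fix x :: real assume x: "x > 0"
    have pw: "((\<lambda>x. x powr r) has_real_derivative r * x powr (r - 1)) (at x)" for r
      using x by (rule has_real_derivative_powr)
    show "((\<lambda>x. x powr \<kappa> * bessel_normalized d x) has_real_derivative y1 x) (at x)"
      unfolding y1_def by (rule DERIV_cong[OF DERIV_mult[OF pw f]]) (simp add: mult_ac)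
    define p where "p = x powr (\<kappa> - 1 - 1)"
    have p1: "x powr \<kappa> = p * (x * x)" "x powr (\<kappa> - 1) = p * x"
      using x by (simp_all add: p_def powr_diff field_simps power2_eq_square)
    have "((\<lambda>x. \<kappa> * x powr (\<kappa> - 1) * bessel_normalized d x + x powr \<kappa> * f1 x) has_real_derivative
      (\<kappa> * ((\<kappa> - 1) * p)) * bessel_normalized d x + f1 x * (\<kappa> * x powr (\<kappa> - 1))
      + (\<kappa> * x powr (\<kappa> - 1) * f1 x + f2 x * x powr \<kappa>)) (at x)"
      unfolding p_def by (intro DERIV_add DERIV_mult DERIV_cmult pw f f1)
    also have "(\<kappa> * ((\<kappa> - 1) * p)) * bessel_normalized d x + f1 x * (\<kappa> * x powr (\<kappa> - 1))
      + (\<kappa> * x powr (\<kappa> - 1) * f1 x + f2 x * x powr \<kappa>)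
      = p * (\<kappa> * (\<kappa> - 1) * bessel_normalized d x + x * (x * f2 x + 2 * \<kappa> * f1 x))"
      unfolding p1 by (simp add: algebra_simps)
    also have "x * f2 x + 2 * \<kappa> * f1 x = - (x * bessel_normalized d x)"
      using ode[of x] by linarith
    also have "p * (\<kappa> * (\<kappa> - 1) * bessel_normalized d x + x * (- (x * bessel_normalized d x)))
      = - (1 - \<kappa> * (\<kappa> - 1) / x\<^sup>2) * (x powr \<kappa> * bessel_normalized d x)"
      unfolding p1 using x by (simp add: field_simps power2_eq_square)
    finally show "(y1 has_real_derivative - (1 - \<kappa> * (\<kappa> - 1) / x\<^sup>2) * (x powr \<kappa> * bessel_normalized d x)) (at x)"
      unfolding y1_def[abs_def] .
    show "1 - \<kappa> * (\<kappa> - 1) / x\<^sup>2 \<le> 1" using k by simp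
    show "1 - \<kappa> * (\<kappa> - 1) / x\<^sup>2 \<le> 1 - \<kappa> * (\<kappa> - 1) / z\<^sup>2" if "x \<le> z" for z
      using k x that by (intro diff_left_mono divide_left_mono power_mono mult_nonneg_nonneg mult_pos_pos) auto
  next
    show "continuous_on {0..} (\<lambda>x. x powr \<kappa> * bessel_normalized d x)"
      using k \<open>d \<ge> 2\<close>
      by (intro continuous_on_mult continuous_on_powr' continuous_on_id continuous_on_const continuous_on_bessel_normalized) auto
  qed
  thus ?thesis by (rule that)
qed

text \<open>Splitting off the first term leaves \<open>B 0\<close> minus the same kind of sum for
  the shifted sequence; this is why the induction generalizes over B.\<close>

lemma alternating_sum_bounds:
  fixes B :: "nat \<Rightarrow> real"
  assumes "\<And>n. 0 \<le> B n" "\<And>n. B (Suc n) \<le> B n"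
  shows "0 \<le> (\<Sum>k<n. (- 1) ^ k * B k) \<and> (\<Sum>k<n. (- 1) ^ k * B k) \<le> B 0"
  using assms
proof (induction n arbitrary: B)
  case (Suc n)
  have "0 \<le> (\<Sum>k<n. (- 1) ^ k * B (Suc k)) \<and> (\<Sum>k<n. (- 1) ^ k * B (Suc k)) \<le> B (Suc 0)"
    using Suc.prems by (intro Suc.IH)
  moreover have "(\<Sum>k<Suc n. (- 1) ^ k * B k) = B 0 - (\<Sum>k<n. (- 1) ^ k * B (Suc k))"
    by (subst sum.lessThan_Suc_shift) (simp add: sum_negf)
  ultimately show ?case using Suc.prems(2)[of 0] by linarith
qed simp

text \<open>The lower bound does not depend on n, so a strict inequality B 1 < B 0 survives the
  passage to the limit.\<close>

lemma alternating_sum_ge: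
  fixes B :: "nat \<Rightarrow> real"
  assumes "\<And>n. 0 \<le> B n" "\<And>n. B (Suc n) \<le> B n"
  shows "B 0 - B 1 \<le> (\<Sum>k<Suc n. (- 1) ^ k * B k)"
proof -
  have "(\<Sum>k<n. (- 1) ^ k * B (Suc k)) \<le> B (Suc 0)"
    using alternating_sum_bounds[of "\<lambda>k. B (Suc k)" n] assms by simp
  moreover have "(\<Sum>k<Suc n. (- 1) ^ k * B k) = B 0 - (\<Sum>k<n. (- 1) ^ k * B (Suc k))"
    by (subst sum.lessThan_Suc_shift) (simp add: sum_negf)
  ultimately show ?thesis by simp
qed

lemma integral_reflect_shift:
  fixes g :: "real \<Rightarrow> real"
  assumes "\<tau> \<ge> 0" "\<And>S. continuous_on S g"
  shows "integral {c..c + \<tau>} g = integral {0..\<tau>} (\<lambda>t. g (c + t))"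
    and "integral {c - \<tau>..c} g = integral {0..\<tau>} (\<lambda>t. g (c - t))"
proof -
  have "((\<lambda>t. 1 *\<^sub>R g (c + t)) has_integral integral {c + 0..c + \<tau>} g) {0..\<tau>}"
    using assms by (intro has_integral_substitution[where c = c and d = "c + \<tau>"])
      (auto intro!: derivative_eq_intros)
  thus "integral {c..c + \<tau>} g = integral {0..\<tau>} (\<lambda>t. g (c + t))" by (simp add: integral_unique)
  \<comment> \<open>An orientation-reversing substitution yields a difference of integrals over the
    two orders of the endpoints; the first interval is empty or a point.\<close>
  have "((\<lambda>t. (- 1) *\<^sub>R g (c - t)) has_integral (integral {c - 0..c - \<tau>} g - integral {c - \<tau>..c - 0} g)) {0..\<tau>}"
    using assms by (intro has_integral_substitution_general[where c = "c - \<tau>" and d = c and s = "{}"])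
      (auto intro!: derivative_eq_intros continuous_intros)
  moreover have "integral {c - 0..c - \<tau>} g = 0" using assms by (cases "\<tau> = 0") auto
  ultimately have "((\<lambda>t. - g (c - t)) has_integral - integral {c - \<tau>..c} g) {0..\<tau>}" by simp
  from has_integral_neg[OF this] show "integral {c - \<tau>..c} g = integral {0..\<tau>} (\<lambda>t. g (c - t))"
    by (simp add: integral_unique)
qed

text \<open>Since Phi(0) = 1, the kernel is positive on some interval (0, delta), and by
  nonnegativity this contribution bounds all later partial integrals from below.\<close>

lemma bessel_kernel_limit_pos_if_nonneg:
  assumes "d \<ge> 2" and lim: "((\<lambda>R. integral {0..R} (bessel_kernel q d)) \<longlongrightarrow> K) at_top"
    and nonneg: "\<And>x. x \<ge> 0 \<Longrightarrow> bessel_kernel q d x \<ge> 0"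
  shows "K > 0"
proof -
  note cont = continuous_on_bessel_kernel[OF \<open>d \<ge> 2\<close>]
  have "isCont (bessel_normalized d) 0"
    using continuous_on_bessel_normalized[OF \<open>d \<ge> 2\<close>, of UNIV] by (simp add: continuous_on_eq_continuous_at)
  hence "eventually (\<lambda>x. bessel_normalized d x > 0) (at 0)"
    by (intro order_tendstoD(1)[of _ 1]) (simp_all add: isCont_def)
  hence "eventually (\<lambda>x. bessel_normalized d x > 0) (at_right 0)"
    by (simp add: eventually_at_split)
  then obtain \<delta> where d: "\<delta> > 0" "\<And>x. 0 < x \<Longrightarrow> x < \<delta> \<Longrightarrow> bessel_normalized d x > 0"
    unfolding eventually_at_right_field by auto
  have "integral {0..\<delta>} (\<lambda>_. 0) < integral {0..\<delta>} (bessel_kernel q d)"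
    using d by (intro integral_less_real cont continuous_intros) (auto simp: bessel_kernel_def intro!: mult_pos_pos)
  also have "integral {0..\<delta>} (bessel_kernel q d) \<le> K"
  proof (rule tendsto_lowerbound[OF lim])
    show "eventually (\<lambda>R. integral {0..\<delta>} (bessel_kernel q d) \<le> integral {0..R} (bessel_kernel q d)) at_top"
      using eventually_ge_at_top[of \<delta>]
      by eventually_elim (auto intro!: integral_subset_le integrable_continuous_real cont nonneg)
  qed simp
  finally show ?thesis by simp
qed

theorem bessel_kernel_limit_pos:
  assumes q: "q \<ge> 3" and d: "d \<ge> 3"
    and lim: "((\<lambda>R. integral {0..R} (bessel_kernel q d)) \<longlongrightarrow> K) at_top"
  shows "K > 0"
\<comment> \<open>In the first case the kernel is nonnegative, through an even power or because Phi
  keeps the sign of Phi(0) = 1. In the second a positive zero is available to close the first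
  arch.\<close>
proof (cases "even q \<or> (\<forall>x>0. bessel_normalized d x \<noteq> 0)")
  case True
  have "bessel_kernel q d x \<ge> 0" if x: "x \<ge> 0" for x
  proof (cases "even q")
    case True
    thus ?thesis using x by (simp add: bessel_kernel_def zero_le_even_power)
  next
    case False
    with \<open>even q \<or> _\<close> have nz: "\<forall>x>0. bessel_normalized d x \<noteq> 0" by simp
    have "bessel_normalized d x \<ge> 0"
    proof (rule ccontr)
      assume "\<not> ?thesis"
      then obtain z where "0 \<le> z" "z \<le> x" "bessel_normalized d z = 0"
        using IVT2'[of "bessel_normalized d" x 0 0] continuous_on_bessel_normalized[of d "{0..x}"] d x by auto
      thus False using nz by (cases "z = 0") auto
    qed
    thus ?thesis using x by (simp add: bessel_kernel_def)
  qed
  thus ?thesis using lim d by (intro bessel_kernel_limit_pos_if_nonneg[of d q K]) auto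
next
  case False
  hence q_odd: "odd q" and "\<exists>x>0. bessel_normalized d x = 0" by auto
  then obtain x0 where x0: "x0 > 0" "bessel_normalized d x0 = 0" by blast
  define \<kappa> where "\<kappa> = (real d - 1) / 2"
  have k: "\<kappa> \<ge> 1" "real (d - 1) = 2 * \<kappa>" using d by (auto simp: \<kappa>_def of_nat_diff)
  define \<Phi> where "\<Phi> = bessel_normalized d"
  define y where "y x = x powr \<kappa> * \<Phi> x" for x
  obtain y1 where "sturm_oscillator y y1 (\<lambda>x. 1 - \<kappa> * (\<kappa> - 1) / x\<^sup>2)"
    using bessel_sturm_oscillator[OF d] unfolding y_def \<kappa>_def \<Phi>_def by blast
  then interpret sturm_oscillator y y1 "\<lambda>x. 1 - \<kappa> * (\<kappa> - 1) / x\<^sup>2" .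
  define h where "h x = \<bar>bessel_kernel q d x\<bar>" for x
  have contk: "continuous_on S (bessel_kernel q d)" for S
    using d by (intro continuous_on_bessel_kernel) auto
  have conth: "continuous_on S h" for S
    unfolding h_def by (intro continuous_intros contk)
  have cont\<Phi>: "continuous_on S \<Phi>" for S
    unfolding \<Phi>_def using d by (intro continuous_on_bessel_normalized) auto
  have h_eq: "h x = \<bar>y x\<bar> ^ q * x powr (- (\<kappa> * (real q - 2)))" if x: "x > 0" for x
  proof -
    have "\<bar>y x\<bar> ^ q = x powr (\<kappa> * real q) * \<bar>\<Phi> x\<bar> ^ q"
      using x powr_realpow[of "x powr \<kappa>" q] by (simp add: y_def abs_mult power_mult_distrib powr_powr)
    moreover have "x powr (\<kappa> * real q) * x powr (- (\<kappa> * (real q - 2))) = x powr (2 * \<kappa>)"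
      by (simp add: powr_add[symmetric] algebra_simps)
    moreover have "x powr (2 * \<kappa>) = x ^ (d - 1)" unfolding k(2)[symmetric] using x by (rule powr_realpow)
    moreover have "h x = \<bar>\<Phi> x\<bar> ^ q * x ^ (d - 1)"
      using x by (simp add: h_def bessel_kernel_def \<Phi>_def abs_mult power_abs)
    ultimately show ?thesis by (simp add: mult_ac)
  qed
  \<comment> \<open>To the right of c, |y| is at most its mirror value and the weight in
    \<open>h_eq\<close> is strictly smaller than its mirror value; the strict inequality comes from
    the weight.\<close>
  have arch_less: "\<exists>e. arch (- s) c e \<and> c + pi \<le> e \<and> integral {c..e} h < integral {b..c} h"
    if A: "arch s b c" and s: "s = 1 \<or> s = -1" for s b c
  proof -
    have bc: "0 \<le> b" "b < c" "y c = 0" using A by (auto simp: arch_def)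
    from next_arch[OF A s] obtain \<tau> where t: "pi \<le> \<tau>" "\<tau> \<le> c - b" "arch (- s) c (c + \<tau>)"
      and le: "\<And>t. 0 < t \<Longrightarrow> t < \<tau> \<Longrightarrow> \<bar>y (c + t)\<bar> \<le> \<bar>y (c - t)\<bar>" by metis
    have t0: "\<tau> > 0" using t(1) pi_gt_zero by linarith
    have "integral {c..c + \<tau>} h = integral {0..\<tau>} (\<lambda>t. h (c + t))"
      using t0 conth by (intro integral_reflect_shift) auto
    also have "\<dots> < integral {0..\<tau>} (\<lambda>t. h (c - t))"
    proof (rule integral_less_real)
      fix r assume "r \<in> {0<..<\<tau>}"
      hence r: "0 < r" "r < \<tau>" "0 < c - r" "0 < c + r" using t bc by auto
      have "- s * y (c + r) > 0" using t(3) r by (simp add: arch_def)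
      hence "y (c + r) \<noteq> 0" by auto
      hence ypos: "\<bar>y (c + r)\<bar> ^ q > 0" by simp
      have "\<kappa> * (real q - 2) > 0" using k q by simp
      hence "(c + r) powr (- (\<kappa> * (real q - 2))) < (c - r) powr (- (\<kappa> * (real q - 2)))"
        using r by (intro powr_less_mono2_neg) auto
      hence "\<bar>y (c + r)\<bar> ^ q * (c + r) powr (- (\<kappa> * (real q - 2))) < \<bar>y (c + r)\<bar> ^ q * (c - r) powr (- (\<kappa> * (real q - 2)))"
        using ypos by (intro mult_strict_left_mono)
      also have "\<dots> \<le> \<bar>y (c - r)\<bar> ^ q * (c - r) powr (- (\<kappa> * (real q - 2)))"
        using le[OF r(1,2)] by (intro mult_right_mono power_mono) auto
      finally show "h (c + r) < h (c - r)" using h_eq r by simp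
    qed (use t0 in \<open>auto intro!: continuous_on_compose2[OF conth[of UNIV]] continuous_intros\<close>)
    also have "\<dots> = integral {c - \<tau>..c} h"
      using t0 conth by (intro integral_reflect_shift(2)[symmetric]) auto
    also have "\<dots> \<le> integral {b..c} h"
      using t by (intro integral_subset_le integrable_continuous_real conth) (auto simp: h_def)
    finally show ?thesis using t by (intro exI[of _ "c + \<tau>"]) auto
  qed
  have "\<exists>c. arch 1 0 c"
  proof -
    define Z where "Z = {0..x0} \<inter> \<Phi> -` {0}"
    have "closed Z" unfolding Z_def by (intro continuous_closed_preimage cont\<Phi>) auto
    moreover have "bounded Z" by (rule bounded_subset[OF bounded_closed_interval[of 0 x0]]) (auto simp: Z_def)
    ultimately have "compact Z" by (simp add: compact_eq_bounded_closed)
    moreover have "x0 \<in> Z" using x0 by (simp add: Z_def \<Phi>_def)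
    hence "Z \<noteq> {}" by blast
    ultimately obtain c where c: "c \<in> Z" "\<And>z. z \<in> Z \<Longrightarrow> c \<le> z"
      by (meson compact_attains_inf)
    have \<Phi>0: "\<Phi> 0 = 1" by (simp add: \<Phi>_def)
    have c0: "0 < c" "c \<le> x0" "\<Phi> c = 0" using c(1) \<Phi>0 by (auto simp: Z_def le_less)
    have "\<Phi> x > 0" if x: "0 < x" "x < c" for x
    proof (rule ccontr)
      assume "\<not> ?thesis"
      then obtain z where "0 \<le> z" "z \<le> x" "\<Phi> z = 0"
        using IVT2'[of \<Phi> x 0 0] cont\<Phi>[of "{0..x}"] \<Phi>0 x by auto
      thus False using c(2)[of z] x c0 by (auto simp: Z_def)
    qed
    \<comment> \<open>\<open>x powr \<kappa>\<close> is 0 at 0, so y has a zero there although Phi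
      does not.\<close>
    hence "arch 1 0 c" using c0 by (auto simp: arch_def y_def)
    thus ?thesis ..
  qed
  then obtain c1 where c1: "arch 1 0 c1" ..
  \<comment> \<open>The state is the pair of endpoints of the n-th arch; the clause for n = 0 keeps
    the fact that the first arch starts at 0.\<close>
  have "\<exists>p. \<forall>n. (arch ((- 1) ^ n) (fst (p n)) (snd (p n)) \<and> (n = 0 \<longrightarrow> fst (p n) = 0)) \<and>
      (fst (p (Suc n)) = snd (p n) \<and> snd (p n) + pi \<le> snd (p (Suc n)) \<and>
       integral {fst (p (Suc n))..snd (p (Suc n))} h < integral {fst (p n)..snd (p n)} h)"
  proof (rule dependent_nat_choice)
    show "\<exists>p. arch ((- 1) ^ 0) (fst p) (snd p) \<and> (0 = (0::nat) \<longrightarrow> fst p = 0)"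
      using c1 by (intro exI[of _ "(0, c1)"]) simp
    fix p :: "real \<times> real" and n :: nat
    assume "arch ((- 1) ^ n) (fst p) (snd p) \<and> (n = 0 \<longrightarrow> fst p = 0)"
    hence "arch ((- 1) ^ n) (fst p) (snd p)" ..
    moreover have "(- 1) ^ n = (1 :: real) \<or> (- 1) ^ n = (- 1 :: real)" by (simp add: minus_one_power_iff)
    ultimately obtain e where e: "arch (- ((- 1) ^ n)) (snd p) e" "snd p + pi \<le> e" "integral {snd p..e} h < integral {fst p..snd p} h"
      using arch_less by blast
    show "\<exists>p'. (arch ((- 1) ^ Suc n) (fst p') (snd p') \<and> (Suc n = 0 \<longrightarrow> fst p' = 0)) \<and>
        (fst p' = snd p \<and> snd p + pi \<le> snd p' \<and> integral {fst p'..snd p'} h < integral {fst p..snd p} h)"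
      using e by (intro exI[of _ "(snd p, e)"]) simp
  qed
  then obtain p :: "nat \<Rightarrow> real \<times> real" where p_all: "\<forall>n. (arch ((- 1) ^ n) (fst (p n)) (snd (p n)) \<and> (n = 0 \<longrightarrow> fst (p n) = 0)) \<and>
      (fst (p (Suc n)) = snd (p n) \<and> snd (p n) + pi \<le> snd (p (Suc n)) \<and>
       integral {fst (p (Suc n))..snd (p (Suc n))} h < integral {fst (p n)..snd (p n)} h)" ..
  have p: "arch ((- 1) ^ n) (fst (p n)) (snd (p n))" "fst (p (Suc n)) = snd (p n)" "snd (p n) + pi \<le> snd (p (Suc n))"
      "integral {fst (p (Suc n))..snd (p (Suc n))} h < integral {fst (p n)..snd (p n)} h" for n
    using p_all by blast+
  have p0: "fst (p 0) = 0" using spec[OF p_all, of 0] by simp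
  define c where "c n = fst (p n)" for n
  have pc: "p n = (c n, c (Suc n))" for n using p(2)[of n] by (simp add: c_def prod_eq_iff)
  have c0: "c 0 = 0" using p0 by (simp add: c_def)
  have arch: "arch ((- 1) ^ n) (c n) (c (Suc n))" for n using p(1)[of n] by (simp add: pc)
  have step: "c (Suc n) + pi \<le> c (Suc (Suc n))" for n using p(3)[of n] by (simp add: pc)
  define B where "B n = integral {c n..c (Suc n)} h" for n
  have B_dec: "B (Suc n) < B n" for n using p(4)[of n] by (simp add: pc B_def)
  have B_nonneg: "B n \<ge> 0" for n unfolding B_def by (intro integral_nonneg integrable_continuous_real conth) (simp add: h_def)
  have c_mono: "0 \<le> c n" "c n \<le> c (Suc n)" for n using arch[of n] by (auto simp: arch_def)
  have arch_integral: "integral {c n..c (Suc n)} (bessel_kernel q d) = (- 1) ^ n * B n" for n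
  proof -
    have "bessel_kernel q d x = (- 1) ^ n * h x" if x: "x \<in> {c n..c (Suc n)}" for x
    proof (cases "x = c n \<or> x = c (Suc n)")
      case True
      hence "y x = 0" "x \<ge> 0" using arch[of n] by (auto simp: arch_def)
      hence "x = 0 \<or> \<Phi> x = 0" by (auto simp: y_def)
      hence "bessel_kernel q d x = 0" using q d by (auto simp: bessel_kernel_def \<Phi>_def power_0_left)
      thus ?thesis by (simp add: h_def)
    next
      case False
      hence x': "x > 0" "(- 1) ^ n * y x > 0" using arch[of n] x c_mono(1)[of n] by (auto simp: arch_def)
      have pw: "x powr \<kappa> > 0" "x ^ (d - 1) > 0" using x' by simp_all
      have K: "bessel_kernel q d x = \<Phi> x ^ q * x ^ (d - 1)" by (simp only: bessel_kernel_def \<Phi>_def)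
      show ?thesis
      proof (cases "even n")
        case True
        hence "\<Phi> x > 0" using x'(2) pw(1) by (simp add: y_def zero_less_mult_iff)
        hence "bessel_kernel q d x \<ge> 0" unfolding K using pw(2) by simp
        thus ?thesis using True by (simp add: h_def)
      next
        case False
        hence "\<Phi> x < 0" using x'(2) pw(1) by (simp add: y_def mult_less_0_iff)
        hence "\<Phi> x ^ q < 0" using q_odd by (simp add: power_less_zero_eq)
        hence "bessel_kernel q d x \<le> 0" unfolding K using pw(2) by (intro mult_nonpos_nonneg less_imp_le)
        thus ?thesis using False by (simp add: h_def)
      qed
    qed
    hence "integral {c n..c (Suc n)} (bessel_kernel q d) = integral {c n..c (Suc n)} (\<lambda>x. (- 1) ^ n * h x)"
      by (rule integral_cong)
    thus ?thesis by (simp add: B_def)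
  qed
  have total: "integral {0..c n} (bessel_kernel q d) = (\<Sum>k<n. (- 1) ^ k * B k)" for n
  proof (induction n)
    case (Suc n)
    have "integral {0..c n} (bessel_kernel q d) + integral {c n..c (Suc n)} (bessel_kernel q d) = integral {0..c (Suc n)} (bessel_kernel q d)"
      by (intro Henstock_Kurzweil_Integration.integral_combine c_mono integrable_continuous_real contk)
    thus ?case using Suc arch_integral[of n] by simp
  qed (simp add: c0)
  \<comment> \<open>The gap of at least pi is known only from \<open>c 1\<close> on, since
    \<open>next_arch\<close> says nothing about the first arch; hence the shifted index.\<close>
  have c_ge: "c (Suc n) \<ge> real n * pi" for n
  proof (induction n)
    case (Suc n)
    thus ?case using step[of n] by (simp add: algebra_simps)
  qed (use c_mono in auto)
  have "filterlim (\<lambda>n. real n * pi) at_top sequentially"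
    by (rule filterlim_at_top_mult_tendsto_pos[OF tendsto_const]) (auto intro: filterlim_real_sequentially)
  hence "filterlim (\<lambda>n. c (Suc n)) at_top sequentially"
    by (rule filterlim_at_top_mono) (use c_ge in auto)
  from filterlim_compose[OF lim this]
  have K: "(\<lambda>n. \<Sum>k<Suc n. (- 1) ^ k * B k) \<longlonglongrightarrow> K" unfolding total .
  have "B 0 - B 1 \<le> (\<Sum>k<Suc n. (- 1) ^ k * B k)" for n
    by (rule alternating_sum_ge[of B, OF B_nonneg less_imp_le[OF B_dec]])
  hence "B 0 - B 1 \<le> K"
    by (intro tendsto_lowerbound[OF K always_eventually] allI) simp_all
  thus ?thesis using B_dec[of 0] by simp
qed

section \<open>The asymptotic formula\<close>

lemma integral_bessel_integrand:
  assumes "d \<ge> 2" "q \<ge> 1"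
  defines "C \<equiv> (2 powr (real d / 2 - 1) * Gamma (real d / 2)) ^ q"
  shows "C > 0" and "x \<ge> 0 \<Longrightarrow> bessel_integrand q d x = 1 / C * bessel_kernel q d x"
    and "integral {0..R} (bessel_integrand q d) = 1 / C * integral {0..R} (bessel_kernel q d)"
    and "bessel_integrand q d integrable_on {0..R}"
    and "bessel_integrand q d absolutely_integrable_on {0..} \<longleftrightarrow> bessel_kernel q d absolutely_integrable_on {0..}"
proof -
  show C: "C > 0" using assms by (auto simp: C_def intro!: Gamma_real_pos)
  show eq: "bessel_integrand q d x = 1 / C * bessel_kernel q d x" if "x \<ge> 0" for x
    using bessel_integrand_eq[OF assms(1,2) that] C
    unfolding C_def[symmetric] bessel_kernel_def[symmetric] by (simp add: field_simps)
  have "integral {0..R} (bessel_integrand q d) = integral {0..R} (\<lambda>x. 1 / C * bessel_kernel q d x)"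
    by (rule integral_cong) (simp add: eq)
  thus "integral {0..R} (bessel_integrand q d) = 1 / C * integral {0..R} (bessel_kernel q d)" by simp
  have "(\<lambda>x. 1 / C * bessel_kernel q d x) integrable_on {0..R}"
    using assms(1) by (intro integrable_continuous_real continuous_on_mult continuous_on_const continuous_on_bessel_kernel)
  thus "bessel_integrand q d integrable_on {0..R}"
    by (rule integrable_eq) (simp add: eq)
  have "bessel_integrand q d absolutely_integrable_on {0..} \<longleftrightarrow> (\<lambda>x. 1 / C * bessel_kernel q d x) absolutely_integrable_on {0..}"
    by (intro set_integrable_cong) (auto simp: eq)
  also have "\<dots> \<longleftrightarrow> bessel_kernel q d absolutely_integrable_on {0..}"
    using C by (subst set_integrable_mult_right_iff) auto
  finally show "bessel_integrand q d absolutely_integrable_on {0..} \<longleftrightarrow> bessel_kernel q d absolutely_integrable_on {0..}" .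
qed

theorem proposition1p1:
  fixes q d :: nat
  assumes "q \<ge> 3" and "d \<ge> 3"
  shows "(\<exists>\<epsilon> :: nat \<Rightarrow> real. \<epsilon> \<in> o(\<lambda>_. 1) \<and>
           (\<forall>l\<ge>1. integral {0..pi / 2}
                     (\<lambda>\<theta>. poly (gegenbauer_poly d l) (cos \<theta>) ^ q * sin \<theta> ^ (d - 1))
                   = gegenbauer_const q d / real l ^ d * (1 + \<epsilon> l)))
       \<and> ((d, q) \<noteq> (3, 3) \<longrightarrow> bessel_integrand q d absolutely_integrable_on {0..})
       \<and> ((d, q) = (3, 3) \<longrightarrow> conditionally_convergent (bessel_integrand q d))"
proof -
  define C where "C = (2 powr (real d / 2 - 1) * Gamma (real d / 2)) ^ q"
  have "d \<ge> 2" "q \<ge> 1" using assms by auto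
  note bi = integral_bessel_integrand[OF this, folded C_def]
  \<comment> \<open>Both cases deliver one K that is the limit on the Gegenbauer side and on the
    Bessel side; the rest of the argument is common to them.\<close>
  have "\<exists>K. ((\<lambda>R. integral {0..R} (bessel_kernel q d)) \<longlongrightarrow> K) at_top \<and>
        (\<lambda>l. real l ^ d * gegenbauer_integral q d l) \<longlonglongrightarrow> K \<and>
        ((d, q) \<noteq> (3, 3) \<longrightarrow> bessel_kernel q d absolutely_integrable_on {0..})"
  proof (cases "(d, q) = (3, 3)")
    case True
    thus ?thesis using bessel_kernel_3_3_improper gegenbauer_integral_3_3_limit by auto
  next
    case False
    interpret absolutely_convergent_case q d "(real d - 1) / 2" "3 * (4 * ((real d - 1) / 2)) powr ((real d - 1) / 2)"
      using assms False by unfold_locales auto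
    show ?thesis
      using tendsto_integral_at_top[OF bessel_kernel_absolutely_integrable]
        gegenbauer_integral_limit bessel_kernel_absolutely_integrable by blast
  qed
  then obtain K where K: "((\<lambda>R. integral {0..R} (bessel_kernel q d)) \<longlongrightarrow> K) at_top"
      and lim: "(\<lambda>l. real l ^ d * gegenbauer_integral q d l) \<longlonglongrightarrow> K"
      and abs: "(d, q) \<noteq> (3, 3) \<Longrightarrow> bessel_kernel q d absolutely_integrable_on {0..}"
    by blast
  have Kpos: "K > 0" using assms K by (rule bessel_kernel_limit_pos)
  have improper: "((\<lambda>R. integral {0..R} (bessel_integrand q d)) \<longlongrightarrow> 1 / C * K) at_top"
    unfolding bi(3) by (intro tendsto_mult tendsto_const K)
  hence "improper_integral (bessel_integrand q d) = 1 / C * K"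
    unfolding improper_integral_def by (intro tendsto_Lim) simp_all
  hence const: "gegenbauer_const q d = K"
    unfolding gegenbauer_const_def C_def[symmetric] using bi(1) by simp
  \<comment> \<open>The claimed identity solved for the error; \<open>Kpos\<close> justifies the
    division by K.\<close>
  define \<epsilon> where "\<epsilon> l = real l ^ d * gegenbauer_integral q d l / K - 1" for l
  have "(\<lambda>l. real l ^ d * gegenbauer_integral q d l / K - 1) \<longlonglongrightarrow> K / K - 1"
    using Kpos by (intro tendsto_intros lim) auto
  hence "\<epsilon> \<longlonglongrightarrow> 0" using Kpos by (simp add: \<epsilon>_def[abs_def])
  hence "\<epsilon> \<in> o(\<lambda>_. 1)" by (intro smalloI_tendsto) auto
  moreover have "integral {0..pi / 2} (\<lambda>\<theta>. poly (gegenbauer_poly d l) (cos \<theta>) ^ q * sin \<theta> ^ (d - 1))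
      = gegenbauer_const q d / real l ^ d * (1 + \<epsilon> l)" if "l \<ge> 1" for l
    unfolding gegenbauer_integral_def[symmetric] const \<epsilon>_def using Kpos that by simp
  moreover have "bessel_integrand q d absolutely_integrable_on {0..}" if "(d, q) \<noteq> (3, 3)"
    using abs[OF that] bi(5) by simp
  moreover have "conditionally_convergent (bessel_integrand q d)" if "(d, q) = (3, 3)"
  proof -
    have "\<not> bessel_integrand q d absolutely_integrable_on {0..}"
      using that bessel_kernel_3_3_not_absolutely_integrable bi(5) by auto
    thus ?thesis
      unfolding conditionally_convergent_def improper_integrable_def using improper bi(4) by blast
  qed
  ultimately show ?thesis by blast
qed

end
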